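(* Let $\mathcal{X}=\varprojlim(S_{n+1}\xrightarrow{\pi_n} S_n)$ be the inverse limit of a tower of finite coverings based on a hyperbolic surface $S=S_0$ of finite area, and let $\mathcal{Y}=T^1\mathcal{X}=\varprojlim(T^1S_{n+1}\xrightarrow{\pi_n} T^1S_n)$ be its unit tangent bundle, with projection $\pi:\mathcal{Y}\to T^1S$ and horocycle flow $h_s$. Then for every $y\in\mathcal{Y}$, either the orbit $h_{\mathbb{R}}(y)$ is dense in $\mathcal{Y}$, or $h_{\mathbb{R}}(y)$ projects under $\pi$ onto a periodic orbit of the horocycle flow on $T^1S$.
   Context: A hyperbolic surface of finite area is $S=\Gamma\backslash\mathbb{H}$ where $\Gamma<\mathrm{PSL}(2,\mathbb{R})$ is a torsion-free lattice, $\Gamma\cong\pi_1(S)$. A tower of finite coverings based on $S$ is given by a decreasing sequence $\Gamma=\Gamma_0>\Gamma_1>\Gamma_2>\cdots$ of finite index subgroups (not necessarily normal): $S_n=\Gamma_n\backslash\mathbb{H}$, and $\pi_n:S_{n+1}\to S_n$ is the natural covering. The unit tangent bundle is $T^1S_n=\Gamma_n\backslash \mathrm{PSL}(2,\mathbb{R})$ and the induced covering $T^1S_{n+1}\to T^1S_n$ is also denoted $\pi_n$. The inverse limit is $$\mathcal{Y}=\Big\{(y_n)_{n\ge 0}\in\prod_{n\ge 0}T^1S_n : \pi_n(y_{n+1})=y_n \text{ for all } n\Big\}$$ with the topology induced by the product topology, and $\pi(y)=y_0$. The (stable) horocycle flow on $T^1S_n$ is $h_s(\Gamma_n u)=\Gamma_n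 u\begin{pmatrix}1&s\\0&1\end{pmatrix}$, $s\in\mathbb{R}$. These flows commute with the coverings $\pi_n$, and the horocycle flow on $\mathcal{Y}$ is $h_s((y_n)_n)=(h_s(y_n))_n$. We write $h_{\mathbb{R}}(y)=\{h_s(y):s\in\mathbb{R}\}$. *)

theory Defs
  imports "HOL-Analysis.Analysis" "HOL-Algebra.Coset"
begin

section \<open>The group PSL(2,R)\<close>

definition SL2R :: "(real^2^2) monoid" where
  "SL2R = \<lparr>carrier = {A. det A = 1}, mult = (**), one = mat 1\<rparr>"

text \<open>An element of PSL(2,R) is a coset, i.e. a pair \<open>{A, - A}\<close> of matrices.\<close>

type_synonym psl = "(real^2^2) set"

definition PSL2R :: "psl monoid" where
  "PSL2R = SL2R Mod {mat 1, - mat 1}"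

definition psl_class :: "real^2^2 \<Rightarrow> psl" where
  "psl_class A = {mat 1, - mat 1} #>\<^bsub>SL2R\<^esub> A"

lemma SL2R_simps [simp]:
  "carrier SL2R = {A. det A = 1}" "A \<otimes>\<^bsub>SL2R\<^esub> B = A ** B" "\<one>\<^bsub>SL2R\<^esub> = mat 1"
  by (simp_all add: SL2R_def)

lemma matrix_minus_left: "(- A) ** B = - (A ** B)" for A B :: "real^2^2"
  by (simp add: matrix_matrix_mult_def vec_eq_iff sum_negf)

lemma matrix_minus_right: "A ** (- B) = - (A ** B)" for A B :: "real^2^2"
  by (simp add: matrix_matrix_mult_def vec_eq_iff sum_negf)

lemma det_minus_2: "det (- A) = det A" for A :: "real^2^2"
  by (simp add: det_2)

lemma group_SL2R: "group SL2R"
proof (rule groupI)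
  fix A assume "A \<in> carrier SL2R"
  then have A: "det A = 1" by simp
  then have "invertible A" by (simp add: invertible_det_nz)
  then obtain B where B: "B ** A = mat 1" by (auto simp: invertible_def)
  then have "det B * det A = 1" by (metis det_mul det_I)
  with A B show "\<exists>B\<in>carrier SL2R. B \<otimes>\<^bsub>SL2R\<^esub> A = \<one>\<^bsub>SL2R\<^esub>"
    by (intro bexI[of _ B]) auto
qed (auto simp: det_mul matrix_mul_assoc)

lemma normal_pm_one: "{mat 1, - mat 1} \<lhd> SL2R"
proof -
  interpret group SL2R by (rule group_SL2R)
  have "inv\<^bsub>SL2R\<^esub> (- mat 1) = - mat 1"
    by (rule inv_equality) (auto simp: matrix_minus_left matrix_minus_right det_minus_2)
  then have sub: "subgroup {mat 1, - mat 1} SL2R"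
    using inv_one
    by unfold_locales (auto simp: matrix_minus_left matrix_minus_right det_minus_2)
  show ?thesis
  proof (rule normalI[OF sub], rule ballI)
    fix A assume "A \<in> carrier SL2R"
    show "{mat 1, - mat 1} #>\<^bsub>SL2R\<^esub> A = A <#\<^bsub>SL2R\<^esub> {mat 1, - mat 1}"
      by (auto simp: r_coset_def l_coset_def matrix_minus_left matrix_minus_right)
  qed
qed

lemma group_PSL2R: "group PSL2R"
  unfolding PSL2R_def by (rule normal.factorgroup_is_group[OF normal_pm_one])

lemma psl_class_eq: "psl_class A = {A, - A}"
  by (auto simp: psl_class_def r_coset_def matrix_minus_left)

lemma carrier_PSL2R: "carrier PSL2R = psl_class ` {A. det A = 1}"
  by (auto simp: PSL2R_def FactGroup_def RCOSETS_def psl_class_def)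

lemma mult_psl_class:
  "det A = 1 \<Longrightarrow> det B = 1 \<Longrightarrow> psl_class A \<otimes>\<^bsub>PSL2R\<^esub> psl_class B = psl_class (A ** B)"
  using normal.rcos_sum[OF normal_pm_one, of A B] by (simp add: PSL2R_def psl_class_def)


section \<open>Quotient topologies\<close>

definition quotient_topology :: "'a topology \<Rightarrow> ('a \<Rightarrow> 'b) \<Rightarrow> 'b topology" where
  "quotient_topology X f =
     topology (\<lambda>U. U \<subseteq> f ` topspace X \<and> openin X {x \<in> topspace X. f x \<in> U})"

lemma openin_quotient_topology:
  "openin (quotient_topology X f) U \<longleftrightarrow>
     U \<subseteq> f ` topspace X \<and> openin X {x \<in> topspace X. f x \<in> U}"
proof -
  have "istopology (\<lambda>U. U \<subseteq> f ` topspace X \<and> openin X {x \<in> topspace X. f x \<in> U})"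
    unfolding istopology_def
  proof (intro conjI allI impI; (elim conjE)?)
    fix S T
    assume "openin X {x \<in> topspace X. f x \<in> S}" "openin X {x \<in> topspace X. f x \<in> T}"
    moreover have "{x \<in> topspace X. f x \<in> S \<inter> T} =
        {x \<in> topspace X. f x \<in> S} \<inter> {x \<in> topspace X. f x \<in> T}" by auto
    ultimately show "openin X {x \<in> topspace X. f x \<in> S \<inter> T}" by auto
  next
    fix K assume "\<forall>S\<in>K. S \<subseteq> f ` topspace X \<and> openin X {x \<in> topspace X. f x \<in> S}"
    moreover have "{x \<in> topspace X. f x \<in> \<Union>K} = (\<Union>S\<in>K. {x \<in> topspace X. f x \<in> S})" by auto
    ultimately show "openin X {x \<in> topspace X. f x \<in> \<Union>K}" by auto
  qed auto
  then show ?thesis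
    by (simp add: quotient_topology_def)
qed

lemma quotient_map_quotient_topology: "quotient_map X (quotient_topology X f) f"
proof -
  have "topspace (quotient_topology X f) = f ` topspace X"
  proof
    show "topspace (quotient_topology X f) \<subseteq> f ` topspace X"
      using openin_topspace openin_quotient_topology by metis
    have "{x \<in> topspace X. f x \<in> f ` topspace X} = topspace X" by auto
    then have "openin (quotient_topology X f) (f ` topspace X)"
      by (simp add: openin_quotient_topology)
    then show "f ` topspace X \<subseteq> topspace (quotient_topology X f)"
      by (rule openin_subset)
  qed
  then show ?thesis
    by (auto simp: quotient_map_def openin_quotient_topology)
qed

definition psl_topology :: "psl topology" where
  "psl_topology = quotient_topology (top_of_set (carrier SL2R)) psl_class"

lemma topspace_psl_topology: "topspace psl_topology = carrier PSL2R"
  using quotient_map_quotient_topology[of "top_of_set (carrier SL2R)" psl_class]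
  by (simp add: psl_topology_def quotient_map_def carrier_PSL2R)


section \<open>The quotients of PSL(2,R) by subgroups, the horocycle flow and lattices\<close>

text \<open>
  PSL(2,R) acts simply transitively on the unit tangent bundle of the hyperbolic plane \<open>\<^bold>H\<close>, so
  the unit tangent bundle of \<open>\<Gamma>\<setminus>\<^bold>H\<close> is the space of cosets \<open>\<Gamma> u\<close>.
\<close>

definition T1 :: "psl set \<Rightarrow> psl set topology" where
  "T1 \<Gamma> = quotient_topology psl_topology (\<lambda>u. \<Gamma> #>\<^bsub>PSL2R\<^esub> u)"

lemma topspace_T1: "topspace (T1 \<Gamma>) = rcosets\<^bsub>PSL2R\<^esub> \<Gamma>"
proof -
  have "topspace (T1 \<Gamma>) = (\<lambda>u. \<Gamma> #>\<^bsub>PSL2R\<^esub> u) ` carrier PSL2R"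
    using quotient_map_quotient_topology[of psl_topology "\<lambda>u. \<Gamma> #>\<^bsub>PSL2R\<^esub> u"]
    by (simp add: T1_def quotient_map_def topspace_psl_topology)
  then show ?thesis by (auto simp: RCOSETS_def)
qed

definition horo :: "real \<Rightarrow> psl set \<Rightarrow> psl set" where
  "horo s x = x #>\<^bsub>PSL2R\<^esub> psl_class (vector [vector [1, s], vector [0, 1]])"

definition horo_orbit :: "psl set \<Rightarrow> psl set set" where
  "horo_orbit x = range (\<lambda>s. horo s x)"

definition horo_periodic :: "psl set \<Rightarrow> bool" where
  "horo_periodic x \<longleftrightarrow> (\<exists>t>0. horo t x = x)"

definition torsion_free :: "psl set \<Rightarrow> bool" where
  "torsion_free \<Gamma> \<longleftrightarrow>
     (\<forall>\<gamma>\<in>\<Gamma>. \<forall>k::nat. k > 0 \<longrightarrow> \<gamma> [^]\<^bsub>PSL2R\<^esub> k = \<one>\<^bsub>PSL2R\<^esub> \<longrightarrow> \<gamma> = \<one>\<^bsub>PSL2R\<^esub>)"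

text \<open>
  A lattice is a discrete subgroup \<open>\<Gamma>\<close> for which \<open>\<Gamma>\<setminus>PSL(2,R)\<close> carries a nonzero finite Borel
  measure invariant under right translations.
\<close>

definition psl_lattice :: "psl set \<Rightarrow> bool" where
  "psl_lattice \<Gamma> \<longleftrightarrow>
     subgroup \<Gamma> PSL2R \<and>
     subtopology psl_topology \<Gamma> = discrete_topology \<Gamma> \<and>
     (\<exists>M. space M = topspace (T1 \<Gamma>) \<and>
          sets M = sigma_sets (topspace (T1 \<Gamma>)) {U. openin (T1 \<Gamma>) U} \<and>
          finite_measure M \<and> emeasure M (space M) \<noteq> 0 \<and>
          (\<forall>g\<in>carrier PSL2R. \<forall>A\<in>sets M.
             emeasure M ((\<lambda>x. x #>\<^bsub>PSL2R\<^esub> g) ` A) = emeasure M A))"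


section \<open>Towers of coverings and their inverse limits\<close>

text \<open>
  For subgroups \<open>K \<subseteq> H\<close>, the covering \<open>K u \<mapsto> H u\<close> is given by \<open>x \<mapsto> H x\<close>, the product set
  of \<open>H\<close> with the coset \<open>x = K u\<close>.
\<close>

definition cov :: "psl set \<Rightarrow> psl set \<Rightarrow> psl set" where
  "cov H x = H <#>\<^bsub>PSL2R\<^esub> x"

lemma cov_r_coset:
  assumes "subgroup H PSL2R" "subgroup K PSL2R" "K \<subseteq> H" "u \<in> carrier PSL2R"
  shows "cov H (K #>\<^bsub>PSL2R\<^esub> u) = H #>\<^bsub>PSL2R\<^esub> u"
proof -
  interpret group PSL2R by (rule group_PSL2R)
  have sub: "H \<subseteq> carrier PSL2R" "K \<subseteq> carrier PSL2R"
    using assms by (auto dest: subgroup.subset)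
  have "H <#>\<^bsub>PSL2R\<^esub> K \<subseteq> H <#>\<^bsub>PSL2R\<^esub> H"
    using assms by (intro mono_set_mult) auto
  moreover have "H \<subseteq> H <#>\<^bsub>PSL2R\<^esub> K"
  proof
    fix h assume h: "h \<in> H"
    then have "h = h \<otimes>\<^bsub>PSL2R\<^esub> \<one>\<^bsub>PSL2R\<^esub>" using sub by auto
    with h subgroup.one_closed[OF assms(2)] show "h \<in> H <#>\<^bsub>PSL2R\<^esub> K"
      by (auto simp: set_mult_def)
  qed
  ultimately have "H <#>\<^bsub>PSL2R\<^esub> K = H"
    using subgroup_mult_id[OF assms(1)] by auto
  then show ?thesis
    using setmult_rcos_assoc[OF sub assms(4)] by (simp add: cov_def)
qed

text \<open>
  The surfaces of the tower are \<open>\<Gamma> n\<setminus>\<^bold>H\<close>.  The inclusions \<open>\<Gamma> (Suc n) \<subseteq> \<Gamma> n\<close> need not be strict.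
\<close>

definition covering_tower :: "(nat \<Rightarrow> psl set) \<Rightarrow> bool" where
  "covering_tower \<Gamma> \<longleftrightarrow>
     psl_lattice (\<Gamma> 0) \<and> torsion_free (\<Gamma> 0) \<and>
     (\<forall>n. subgroup (\<Gamma> n) PSL2R \<and> \<Gamma> (Suc n) \<subseteq> \<Gamma> n \<and>
          finite (rcosets\<^bsub>PSL2R\<lparr>carrier := \<Gamma> 0\<rparr>\<^esub> \<Gamma> n))"

definition inv_limit :: "(nat \<Rightarrow> psl set) \<Rightarrow> (nat \<Rightarrow> psl set) topology" where
  "inv_limit \<Gamma> = subtopology (product_topology (\<lambda>n. T1 (\<Gamma> n)) UNIV)
     {y. \<forall>n. cov (\<Gamma> n) (y (Suc n)) = y n}"

definition limit_proj :: "(nat \<Rightarrow> psl set) \<Rightarrow> psl set" where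
  "limit_proj y = y 0"

definition limit_horo :: "real \<Rightarrow> (nat \<Rightarrow> psl set) \<Rightarrow> (nat \<Rightarrow> psl set)" where
  "limit_horo s y = (\<lambda>n. horo s (y n))"

definition limit_orbit :: "(nat \<Rightarrow> psl set) \<Rightarrow> (nat \<Rightarrow> psl set) set" where
  "limit_orbit y = range (\<lambda>s. limit_horo s y)"

end

theory Submission
  imports Defs
begin

text \<open>
  A basic open set of the inverse limit is the preimage of an open set at a single level \<open>n\<close>, so the
  orbit of \<open>y\<close> is dense in the limit as soon as the horocycle of each component \<open>y n\<close> is dense in
  \<open>T1 (\<Gamma> n)\<close>. If one of these horocycles is not dense, then by Hedlund's theorem it is periodic, and
  its image, the horocycle of \<open>y 0\<close>, is periodic too. So the matter is Hedlund's theorem for each lattice \<open>\<Gamma> n\<close>: a horocycle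
  is periodic or dense (\<open>horocycle_closed_or_dense\<close>). That a subgroup of finite index again has a finite
  invariant measure is shown by counting points in the fibres of the covering
  (\<open>lattice_measure_finite_index\<close>).

  Hedlund's theorem is proved as follows for a lattice \<open>D\<close>, viewed in \<open>SL(2,R)\<close>, and the horocycle of
  a matrix \<open>g\<close>. Look at the group \<open>D\<close> from the points \<open>g ** dg l\<close> of a geodesic asymptotic to this
  horocycle.

  If nontrivial elements of \<open>D\<close> get arbitrarily close to the identity as seen from these points, as
  \<open>l\<close> tends to infinity, then small elements commute (\<open>small_elements_commute\<close>), whence those found
  for all large \<open>l\<close> commute with each other. This forces them to be unipotent and to translate the
  horocycle along itself (\<open>unipotent_if_small_elements\<close>), so that it is periodic.

  Otherwise there are arbitrarily large \<open>l\<close> for which a tube around a piece of the horocycle of length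
  about \<open>l\<^sup>2\<close> embeds in the quotient and has a measure bounded below independently of \<open>l\<close>
  (\<open>measure_tube_lower\<close>). The horocycle flow is ergodic by the Mautner phenomenon
  (\<open>horocycle_ergodic\<close>), so the points from which a given open set is reached within bounded
  time have almost full measure (\<open>horocycle_saturation_large\<close>). They meet the tube, and since the tube
  is very thin, the horocycle itself enters the open set (\<open>dense_if_thick\<close>).
\<close>

section \<open>Real matrices of size two\<close>

definition mk :: "real \<Rightarrow> real \<Rightarrow> real \<Rightarrow> real \<Rightarrow> real^2^2" where
  "mk a b c d = vector [vector [a, b], vector [c, d]]"

abbreviation SL :: "(real^2^2) set" where "SL \<equiv> {A. det A = 1}"

lemma mk_nth [simp]:
  "mk a b c d $ 1 $ 1 = a" "mk a b c d $ 1 $ 2 = b"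
  "mk a b c d $ 2 $ 1 = c" "mk a b c d $ 2 $ 2 = d"
  by (simp_all add: mk_def)

lemma mk_cases [cases type]: obtains a b c d where "A = mk a b c d"
proof
  show "A = mk (A$1$1) (A$1$2) (A$2$1) (A$2$2)"
    by (simp add: vec_eq_iff forall_2)
qed

lemma mk_eq_iff [simp]:
  "mk a b c d = mk a' b' c' d' \<longleftrightarrow> a = a' \<and> b = b' \<and> c = c' \<and> d = d'"
  by (auto simp: vec_eq_iff forall_2)

lemma mk_mult [simp]:
  "mk a b c d ** mk a' b' c' d' = mk (a*a' + b*c') (a*b' + b*d') (c*a' + d*c') (c*b' + d*d')"
  by (simp add: vec_eq_iff forall_2 matrix_matrix_mult_def sum_2)

lemma det_mk [simp]: "det (mk a b c d) = a * d - b * c"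
  by (simp add: det_2)

lemma mat_1_mk: "mat 1 = mk 1 0 0 1"
  by (simp add: vec_eq_iff forall_2 mat_def)

lemma uminus_mk [simp]: "- mk a b c d = mk (-a) (-b) (-c) (-d)"
  by (simp add: vec_eq_iff forall_2)

text \<open>
  The adjugate is the inverse on \<open>SL\<close>. Being linear in the entries, it is continuous and
  preserves every bound on the distance of the entries from those of the identity.
\<close>
definition adj :: "real^2^2 \<Rightarrow> real^2^2" where
  "adj A = mk (A$2$2) (- A$1$2) (- A$2$1) (A$1$1)"

lemma adj_mk [simp]: "adj (mk a b c d) = mk d (-b) (-c) a"
  by (simp add: adj_def)

lemma adj_SL [simp]: "det (adj A) = det A"
  by (cases A) simp

lemma adj_adj [simp]: "adj (adj A) = A"
  by (cases A) simp

lemma adj_mult: "adj (A ** B) = adj B ** adj A"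
  by (cases A; cases B) (simp add: algebra_simps)

lemma adj_1 [simp]: "adj (mat 1) = mat 1"
  by (simp add: mat_1_mk)

lemma mult_adj [simp]:
  assumes "det A = 1"
  shows "A ** adj A = mat 1" "adj A ** A = mat 1"
    "B ** A ** adj A = B" "B ** adj A ** A = B"
    "adj A ** (A ** B) = B" "A ** (adj A ** B) = B"
proof -
  show *: "A ** adj A = mat 1" "adj A ** A = mat 1"
    using assms by (cases A; simp add: mat_1_mk algebra_simps)+
  then show "B ** A ** adj A = B" "B ** adj A ** A = B"
    "adj A ** (A ** B) = B" "A ** (adj A ** B) = B"
    by (metis matrix_mul_assoc matrix_mul_rid matrix_mul_lid)+
qed

lemma continuous_on_mult_left: "continuous_on S (\<lambda>A. (B :: real^2^2) ** A)"
  unfolding matrix_matrix_mult_def by (intro continuous_intros)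

lemma continuous_on_mult_right: "continuous_on S (\<lambda>A. A ** (B :: real^2^2))"
  unfolding matrix_matrix_mult_def by (intro continuous_intros)

abbreviation openSL :: "(real^2^2) set \<Rightarrow> bool" where
  "openSL \<equiv> openin (top_of_set SL)"

lemma openSL_left_translate:
  assumes "openSL S" "det L = 1"
  shows "openSL {A \<in> SL. L ** A \<in> S}"
proof -
  from assms obtain T where T: "open T" "S = SL \<inter> T"
    by (auto simp: openin_open)
  have "open ((\<lambda>A. L ** A) -` T)"
    using T(1) continuous_on_mult_left by (rule open_vimage)
  moreover have "{A \<in> SL. L ** A \<in> S} = SL \<inter> ((\<lambda>A. L ** A) -` T)"
    using assms T by (auto simp: det_mul)
  ultimately show ?thesis by (auto simp: openin_open)
qed

lemma openSL_right_translate: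
  assumes "openSL S" "det L = 1"
  shows "openSL {A \<in> SL. A ** L \<in> S}"
proof -
  from assms obtain T where T: "open T" "S = SL \<inter> T"
    by (auto simp: openin_open)
  have "open ((\<lambda>A. A ** L) -` T)"
    using T(1) continuous_on_mult_right by (rule open_vimage)
  moreover have "{A \<in> SL. A ** L \<in> S} = SL \<inter> ((\<lambda>A. A ** L) -` T)"
    using assms T by (auto simp: det_mul)
  ultimately show ?thesis by (auto simp: openin_open)
qed

lemma right_image_eq:
  assumes "S \<subseteq> SL" "det L = 1"
  shows "(\<lambda>A. A ** L) ` S = {A \<in> SL. A ** adj L \<in> S}"
proof -
  have "A \<in> (\<lambda>A. A ** L) ` S" if "A ** adj L \<in> S" for A
    using that assms by (intro image_eqI[of _ _ "A ** adj L"]) auto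
  then show ?thesis using assms by (auto simp: det_mul)
qed

lemma left_image_eq:
  assumes "S \<subseteq> SL" "det L = 1"
  shows "(\<lambda>A. L ** A) ` S = {A \<in> SL. adj L ** A \<in> S}"
proof -
  have "A \<in> (\<lambda>A. L ** A) ` S" if "adj L ** A \<in> S" for A
    using that assms by (intro image_eqI[of _ _ "adj L ** A"]) auto
  then show ?thesis using assms by (auto simp: det_mul)
qed

text \<open>
  The sets \<open>near \<delta>\<close> form a basis of neighbourhoods of the identity in \<open>SL\<close> for which products
  and inverses are easily estimated entry by entry.
\<close>
definition near :: "real \<Rightarrow> real^2^2 \<Rightarrow> bool" where
  "near \<delta> A \<longleftrightarrow> \<bar>A$1$1 - 1\<bar> < \<delta> \<and> \<bar>A$1$2\<bar> < \<delta> \<and> \<bar>A$2$1\<bar> < \<delta> \<and> \<bar>A$2$2 - 1\<bar> < \<delta>"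

lemma near_mk [simp]:
  "near \<delta> (mk a b c d) \<longleftrightarrow> \<bar>a - 1\<bar> < \<delta> \<and> \<bar>b\<bar> < \<delta> \<and> \<bar>c\<bar> < \<delta> \<and> \<bar>d - 1\<bar> < \<delta>"
  by (simp add: near_def)

lemma near_1 [simp]: "0 < \<delta> \<Longrightarrow> near \<delta> (mat 1)"
  by (simp add: mat_1_mk)

lemma near_adj [simp]: "near \<delta> (adj A) \<longleftrightarrow> near \<delta> A"
  by (cases A) auto

lemma near_mono: "near \<delta> A \<Longrightarrow> \<delta> \<le> \<epsilon> \<Longrightarrow> near \<epsilon> A"
  by (auto simp: near_def)

lemma near_mult:
  assumes "near \<alpha> A" "near \<beta> B"
  shows "near (\<alpha> + \<beta> + 2 * \<alpha> * \<beta>) (A ** B)"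
proof -
  obtain a b c d where A: "A = mk a b c d" by (cases A)
  obtain a' b' c' d' where B: "B = mk a' b' c' d'" by (cases B)
  have p: "\<bar>x * y\<bar> < \<alpha> * \<beta>" if "\<bar>x\<bar> < \<alpha>" "\<bar>y\<bar> < \<beta>" for x y
    using that by (simp add: abs_mult mult_strict_mono')
  have q: "\<bar>x + y + z + w\<bar> < \<alpha> + \<beta> + 2 * \<alpha> * \<beta>"
    if "\<bar>x\<bar> < \<alpha> * \<beta>" "\<bar>y\<bar> < \<alpha>" "\<bar>z\<bar> < \<beta>" "\<bar>w\<bar> < \<alpha> * \<beta>" for x y z w
    using that by (simp add: abs_less_iff)
  have eq: "a*a' + b*c' - 1 = (a-1)*(a'-1) + (a-1) + (a'-1) + b*c'"
    "a*b' + b*d' = (a-1)*b' + b + b' + b*(d'-1)"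
    "c*a' + d*c' = c*(a'-1) + c + c' + (d-1)*c'"
    "c*b' + d*d' - 1 = c*b' + (d-1) + (d'-1) + (d-1)*(d'-1)"
    by (simp_all add: algebra_simps)
  have *: "\<bar>a - 1\<bar> < \<alpha>" "\<bar>b\<bar> < \<alpha>" "\<bar>c\<bar> < \<alpha>" "\<bar>d - 1\<bar> < \<alpha>"
    "\<bar>a' - 1\<bar> < \<beta>" "\<bar>b'\<bar> < \<beta>" "\<bar>c'\<bar> < \<beta>" "\<bar>d' - 1\<bar> < \<beta>"
    using assms by (auto simp: A B)
  show ?thesis
    unfolding A B mk_mult near_mk eq by (intro conjI q p *)
qed

lemma open_near: "open {A. near \<delta> A}"
  unfolding near_def
  by (intro open_Collect_conj open_Collect_less continuous_intros)

lemma openSL_near: "openSL {A \<in> SL. near \<delta> A}"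
  using open_near[of \<delta>] by (auto simp: openin_open)

lemma ex_near:
  assumes "openSL S" "B \<in> S"
  obtains \<delta> where "0 < \<delta>" "\<And>A. A \<in> SL \<Longrightarrow> near \<delta> A \<Longrightarrow> B ** A \<in> S"
proof -
  have "B \<in> SL" using assms openin_subset by fastforce
  then have "openSL {A \<in> SL. B ** A \<in> S}"
    using openSL_left_translate[OF assms(1)] by simp
  then obtain T where T: "open T" "{A \<in> SL. B ** A \<in> S} = SL \<inter> T"
    by (auto simp: openin_open)
  have "mat 1 \<in> T" using T(2) assms(2) by (force simp: mat_1_mk[symmetric])
  then obtain e where e: "e > 0" "ball (mat 1) e \<subseteq> T"
    using T(1) open_contains_ball by blast
  show ?thesis
  proof
    show "0 < e / 4" using e by simp
    fix A assume A: "A \<in> SL" "near (e/4) A"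
    have "norm (A - mat 1) \<le> (\<Sum>i\<in>UNIV. norm ((A - mat 1) $ i))"
      by (simp add: norm_vec_def L2_set_le_sum)
    also have "\<dots> \<le> (\<Sum>i\<in>UNIV. \<Sum>j\<in>UNIV. \<bar>(A - mat 1) $ i $ j\<bar>)"
      by (intro sum_mono norm_le_l1_cart)
    also have "\<dots> < e"
      using A(2) by (auto simp: sum_2 near_def mat_def)
    finally have "A \<in> T" using e by (auto simp: dist_norm norm_minus_commute)
    with A T show "B ** A \<in> S" by auto
  qed
qed

section \<open>Small elements of discrete subgroups\<close>

text \<open>
  For a subgroup it is enough to isolate the identity, as translations are homeomorphisms.
\<close>
definition discrete_subgroup :: "(real^2^2) set \<Rightarrow> bool" where
  "discrete_subgroup D \<longleftrightarrow> D \<subseteq> SL \<and> mat 1 \<in> D \<and> (\<forall>A\<in>D. \<forall>B\<in>D. A ** B \<in> D) \<and>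
     (\<forall>A\<in>D. adj A \<in> D) \<and> (\<exists>\<epsilon>>0. \<forall>A\<in>D. near \<epsilon> A \<longrightarrow> A = mat 1)"

lemma discrete_subgroup_SL: "discrete_subgroup D \<Longrightarrow> A \<in> D \<Longrightarrow> det A = 1"
  unfolding discrete_subgroup_def by blast

lemma discrete_subgroup_isolated:
  assumes "discrete_subgroup D"
  obtains \<epsilon> where "\<epsilon> > 0" "\<And>A. A \<in> D \<Longrightarrow> near \<epsilon> A \<Longrightarrow> A = mat 1"
  using assms unfolding discrete_subgroup_def by blast

lemma discrete_subgroup_closed:
  assumes "discrete_subgroup D"
  shows "mat 1 \<in> D" "A \<in> D \<Longrightarrow> B \<in> D \<Longrightarrow> A ** B \<in> D" "A \<in> D \<Longrightarrow> adj A \<in> D"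
  using assms unfolding discrete_subgroup_def by blast+

lemma discrete_subgroup_conj:
  assumes "discrete_subgroup D" "det w = 1"
  shows "discrete_subgroup ((\<lambda>A. adj w ** A ** w) ` D)" (is "discrete_subgroup ?D")
proof -
  obtain \<epsilon> where \<epsilon>: "\<epsilon> > 0" "\<And>A. A \<in> D \<Longrightarrow> near \<epsilon> A \<Longrightarrow> A = mat 1"
    using discrete_subgroup_isolated[OF assms(1)] by blast
  have "openSL {A \<in> SL. w ** A \<in> {A \<in> SL. A ** adj w \<in> {A \<in> SL. near \<epsilon> A}}}"
    using assms by (intro openSL_left_translate openSL_right_translate openSL_near) auto
  then obtain \<delta> where \<delta>: "\<delta> > 0"
    "\<And>A. A \<in> SL \<Longrightarrow> near \<delta> A \<Longrightarrow> near \<epsilon> (w ** A ** adj w)"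
    by (rule ex_near[of _ "mat 1"]) (use assms \<epsilon> in \<open>auto simp: mat_1_mk[symmetric]\<close>)
  have "A = mat 1" if "A \<in> D" "near \<delta> (adj w ** A ** w)" for A
  proof -
    have "det A = 1" using that assms discrete_subgroup_SL by blast
    then have "near \<epsilon> (w ** (adj w ** A ** w) ** adj w)"
      using that assms by (intro \<delta>) (auto simp: det_mul)
    moreover have "w ** (adj w ** A ** w) ** adj w = A"
      using assms by (simp add: matrix_mul_assoc)
    ultimately show ?thesis using \<epsilon> that by auto
  qed
  then have isolated: "\<exists>\<epsilon>>0. \<forall>A\<in>?D. near \<epsilon> A \<longrightarrow> A = mat 1"
    using \<delta>(1) mult_adj(2)[OF assms(2)] by (intro exI[of _ \<delta>]) fastforce
  have closed: "(adj w ** A ** w) ** (adj w ** B ** w) \<in> ?D" if "A \<in> D" "B \<in> D" for A B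
    using that assms discrete_subgroup_closed[OF assms(1)]
    by (intro image_eqI[of _ _ "A ** B"]) (simp_all add: matrix_mul_assoc)
  have "adj (adj w ** A ** w) \<in> ?D" if "A \<in> D" for A
    using that discrete_subgroup_closed[OF assms(1)]
    by (intro image_eqI[of _ _ "adj A"]) (simp_all add: adj_mult matrix_mul_assoc)
  moreover have "mat 1 \<in> ?D"
    using assms discrete_subgroup_closed(1) by (intro image_eqI[of _ _ "mat 1"]) auto
  moreover have "?D \<subseteq> SL"
    using assms discrete_subgroup_SL by (force simp: det_mul)
  ultimately show ?thesis
    using isolated closed unfolding discrete_subgroup_def by blast
qed

lemma commute_iff:
  "mk a b c d ** mk a' b' c' d' = mk a' b' c' d' ** mk a b c d \<longleftrightarrow>
     b * c' = c * b' \<and> (a - d) * b' = (a' - d') * b \<and> (a - d) * c' = (a' - d') * c"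
  by (auto simp: algebra_simps)

text \<open>
  The centralizer of a matrix that is not scalar consists of its linear combinations with the
  identity, and these commute with each other. The sign condition excludes \<open>- mat 1\<close>.
\<close>
lemma commute_trans:
  assumes "det w = 1" "w$1$1 > 0" "w \<noteq> mat 1" "x ** w = w ** x" "y ** w = w ** y"
  shows "x ** y = y ** (x :: real^2^2)"
proof -
  obtain p q r s where w: "w = mk p q r s" by (cases w)
  obtain a b c d where x: "x = mk a b c d" by (cases x)
  obtain a' b' c' d' where y: "y = mk a' b' c' d'" by (cases y)
  have "p - s \<noteq> 0 \<or> q \<noteq> 0 \<or> r \<noteq> 0"
  proof (rule ccontr)
    assume "\<not> ?thesis"
    then have "p\<^sup>2 = 1" "q = 0" "r = 0" "s = p" "p > 0"
      using assms by (auto simp: w power2_eq_square)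
    then have "w = mat 1" by (auto simp: w mat_1_mk power2_eq_1_iff)
    with assms show False by simp
  qed
  then have par: "\<exists>t. u = t * (p - s) \<and> v = t * q \<and> z = t * r"
    if "v * r = z * q" "u * q = (p - s) * v" "u * r = (p - s) * z" for u v z
  proof (elim disjE)
    assume "p - s \<noteq> 0" then show ?thesis using that
      by (intro exI[of _ "u / (p - s)"]) (simp add: field_simps)
  next
    assume "q \<noteq> 0" then show ?thesis using that
      by (intro exI[of _ "v / q"]) (simp add: field_simps)
  next
    assume "r \<noteq> 0" then show ?thesis using that
      by (intro exI[of _ "z / r"]) (simp add: field_simps)
  qed
  obtain t where "a - d = t * (p - s)" "b = t * q" "c = t * r"
    using par[of b c "a - d"] assms(4) by (auto simp: w x commute_iff simp del: mk_mult)
  moreover obtain t' where "a' - d' = t' * (p - s)" "b' = t' * q" "c' = t' * r"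
    using par[of b' c' "a' - d'"] assms(5) by (auto simp: w y commute_iff simp del: mk_mult)
  ultimately show ?thesis unfolding x y commute_iff by simp
qed

lemma matrix_add_rdistrib_2: "(A + B) ** C = A ** C + B ** (C :: real^2^2)"
  by (simp add: matrix_matrix_mult_def vec_eq_iff sum_2 algebra_simps)

text \<open>
  With \<open>Z = z - 1\<close> and \<open>W = w - 1\<close> one has \<open>[z, w] - 1 = (Z W - W Z) z\<inverse> w\<inverse>\<close>, which is bilinear in
  \<open>Z\<close> and \<open>W\<close>. So taking the commutator with a fixed element close to the identity contracts
  towards the identity.
\<close>
lemma commutator_near:
  assumes "det z = 1" "det w = 1" "near (1/16) z" "near \<beta> w" "\<beta> \<le> 1/16"
  shows "near (\<beta>/2) (z ** w ** (adj z ** adj w))"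
proof -
  have shift: "\<exists>a b c d. A = mk (1 + a) b c (1 + d)" for A
    by (rule exI[of _ "A$1$1 - 1"], rule exI[of _ "A$1$2"], rule exI[of _ "A$2$1"],
      rule exI[of _ "A$2$2 - 1"]) (simp add: vec_eq_iff forall_2)
  obtain a b c d where z: "z = mk (1+a) b c (1+d)" using shift by blast
  obtain a' b' c' d' where w: "w = mk (1+a') b' c' (1+d')" using shift by blast
  have \<beta>: "\<beta> > 0" using assms(4) by (auto simp: near_def)
  have "near (1/16 + \<beta> + 2 * (1/16) * \<beta>) (adj z ** adj w)"
    using assms by (intro near_mult) auto
  then have "near (1/7) (adj z ** adj w)"
    using \<beta> assms(5) by (elim near_mono) auto
  moreover obtain e f g h where D0: "adj z ** adj w = mk (1+e) f g (1+h)" using shift by blast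
  ultimately have D: "adj z ** adj w = mk (1+e) f g (1+h)"
    "\<bar>e\<bar> < 1/7" "\<bar>f\<bar> < 1/7" "\<bar>g\<bar> < 1/7" "\<bar>h\<bar> < 1/7"
    by simp_all
  have sm: "\<bar>a\<bar> < 1/16" "\<bar>b\<bar> < 1/16" "\<bar>c\<bar> < 1/16" "\<bar>d\<bar> < 1/16"
    "\<bar>a'\<bar> < \<beta>" "\<bar>b'\<bar> < \<beta>" "\<bar>c'\<bar> < \<beta>" "\<bar>d'\<bar> < \<beta>"
    using assms(3,4) by (auto simp: z w)
  have p: "\<bar>x * y\<bar> < \<beta> / 16" if "\<bar>x\<bar> < 1/16" "\<bar>y\<bar> < \<beta>" for x y
    using mult_strict_mono'[of "\<bar>x\<bar>" "1/16" "\<bar>y\<bar>" \<beta>] that by (simp add: abs_mult)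
  define C11 C12 C21 where "C11 = b*c' - b'*c" "C12 = a*b' + b*d' - a'*b - b'*d"
    "C21 = c*a' + d*c' - c'*a - d'*c"
  have four: "\<bar>x + y - u - v\<bar> < \<beta>/4"
    if "\<bar>x\<bar> < \<beta>/16" "\<bar>y\<bar> < \<beta>/16" "\<bar>u\<bar> < \<beta>/16" "\<bar>v\<bar> < \<beta>/16" for x y u v
    using that by linarith
  have p': "\<bar>y * x\<bar> < \<beta> / 16" if "\<bar>x\<bar> < 1/16" "\<bar>y\<bar> < \<beta>" for x y
    using p[OF that] by (simp add: mult.commute)
  have "\<bar>b*c' + 0 - b'*c - 0\<bar> < \<beta>/4"
    using \<beta> by (intro four p p' sm) simp_all
  then have C: "\<bar>C11\<bar> < \<beta>/4" "\<bar>C12\<bar> < \<beta>/4" "\<bar>C21\<bar> < \<beta>/4"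
    unfolding C11_C12_C21_def diff_zero add_0_right by (assumption | intro four p p' sm)+
  have "z ** w - w ** z = mk C11 C12 C21 (-C11)"
    by (simp add: z w C11_C12_C21_def vec_eq_iff forall_2 algebra_simps)
  moreover have "w ** z ** (adj z ** adj w) = mat 1"
    using assms by (simp add: matrix_mul_assoc)
  ultimately have "z ** w ** (adj z ** adj w) = mat 1 + mk C11 C12 C21 (-C11) ** (adj z ** adj w)"
    by (metis (no_types, lifting) add.commute diff_add_cancel matrix_add_rdistrib_2)
  also have "\<dots> = mk (1 + (C11 * (1+e) + C12 * g)) (C11 * f + C12 * (1+h))
      (C21 * (1+e) + (-C11) * g) (1 + (C21 * f + (-C11) * (1+h)))"
    by (simp add: D mat_1_mk vec_eq_iff forall_2)
  finally have *: "z ** w ** (adj z ** adj w) = \<dots>" .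
  have r: "\<bar>x * u + y * v\<bar> < \<beta>/2"
    if "\<bar>x\<bar> < \<beta>/4" "\<bar>y\<bar> < \<beta>/4" "\<bar>u\<bar> + \<bar>v\<bar> < 9/7" for x y u v
  proof -
    have "\<bar>x * u + y * v\<bar> \<le> \<bar>x\<bar> * \<bar>u\<bar> + \<bar>y\<bar> * \<bar>v\<bar>"
      by (metis abs_mult abs_triangle_ineq)
    also have "\<dots> \<le> \<beta>/4 * \<bar>u\<bar> + \<beta>/4 * \<bar>v\<bar>"
      using that by (intro add_mono mult_right_mono) auto
    also have "\<dots> = \<beta>/4 * (\<bar>u\<bar> + \<bar>v\<bar>)" by (simp add: algebra_simps)
    also have "\<dots> \<le> \<beta>/4 * (9/7)" using that \<beta> by (intro mult_left_mono) auto
    also have "\<dots> < \<beta>/2" using \<beta> by simp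
    finally show ?thesis .
  qed
  have C': "\<bar>- C11\<bar> < \<beta>/4" using C(1) by simp
  have "\<bar>1 + e\<bar> < 8/7" "\<bar>1 + h\<bar> < 8/7" using D(2,5) by linarith+
  then have e1: "\<bar>1 + e\<bar> + \<bar>g\<bar> < 9/7" "\<bar>f\<bar> + \<bar>1 + h\<bar> < 9/7"
    using D(3,4) by simp_all
  have "\<bar>C11 * (1+e) + C12 * g\<bar> < \<beta>/2" "\<bar>C11 * f + C12 * (1+h)\<bar> < \<beta>/2"
    "\<bar>C21 * (1+e) + (-C11) * g\<bar> < \<beta>/2" "\<bar>C21 * f + (-C11) * (1+h)\<bar> < \<beta>/2"
    by (rule r[OF C(1,2) e1(1)] r[OF C(1,2) e1(2)] r[OF C(3) C' e1(1)] r[OF C(3) C' e1(2)])+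
  then show ?thesis unfolding * near_mk by auto
qed

text \<open>
  This is the argument of Zassenhaus. Let \<open>w\<close> be an element of \<open>D\<close> other than the identity whose
  distance from the identity is less than twice the infimum \<open>i\<close> of these distances. For each small
  \<open>z\<close> in \<open>D\<close> the commutator \<open>[z, w]\<close> is at distance less than \<open>i\<close>, so it is trivial. Hence all
  small elements commute with \<open>w\<close>, and then with each other.
\<close>
lemma small_elements_commute:
  assumes D: "discrete_subgroup D" and xy: "x \<in> D" "y \<in> D" "near (1/16) x" "near (1/16) y"
  shows "x ** y = y ** x"
proof (cases "x = mat 1")
  case False
  define nu :: "real^2^2 \<Rightarrow> real" where
    "nu A = max (max \<bar>A$1$1 - 1\<bar> \<bar>A$1$2\<bar>) (max \<bar>A$2$1\<bar> \<bar>A$2$2 - 1\<bar>)" for A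
  have nu: "near \<delta> A \<longleftrightarrow> nu A < \<delta>" for \<delta> A
    by (auto simp: nu_def near_def)
  define E where "E = {A \<in> D. A \<noteq> mat 1 \<and> near (1/16) A}"
  obtain \<epsilon> where \<epsilon>: "\<epsilon> > 0" "\<And>A. A \<in> D \<Longrightarrow> near \<epsilon> A \<Longrightarrow> A = mat 1"
    using discrete_subgroup_isolated[OF D] by blast
  have lb: "\<epsilon> \<le> nu A" if "A \<in> E" for A
    using that \<epsilon>(2)[of A] by (fastforce simp: E_def nu not_less[symmetric])
  have "x \<in> E" using False xy by (auto simp: E_def)
  then have ne: "nu ` E \<noteq> {}" and bdd: "bdd_below (nu ` E)"
    using lb by (auto intro!: bdd_belowI2)
  define i where "i = Inf (nu ` E)"
  have "\<epsilon> \<le> i" unfolding i_def using ne lb by (intro cInf_greatest) auto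
  then have "i < 2 * i" using \<epsilon>(1) by simp
  then obtain w where w: "w \<in> E" "nu w < 2 * i"
    using cInf_lessD[OF ne, of "2 * i"] unfolding i_def by auto
  have comm: "z ** w = w ** z" if z: "z \<in> D" "near (1/16) z" for z
  proof -
    define k where "k = z ** w ** (adj z ** adj w)"
    have dets: "det z = 1" "det w = 1" using z w discrete_subgroup_SL[OF D] by (auto simp: E_def)
    have "k \<in> D" using z w discrete_subgroup_closed[OF D] by (auto simp: E_def k_def)
    moreover have "near (min (2 * i) (1/16) / 2) k"
      unfolding k_def using z w dets by (intro commutator_near) (auto simp: nu E_def)
    then have "nu k < i" "near (1/16) k" by (auto simp: nu)
    ultimately have "k = mat 1"
      using cInf_lower[OF _ bdd] unfolding i_def[symmetric] by (force simp: E_def)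
    then have "k ** (w ** z) = w ** z" by simp
    then show ?thesis using dets by (simp add: k_def matrix_mul_assoc)
  qed
  show ?thesis
  proof (rule commute_trans[of w])
    have "w \<in> D" "near (1/16) w" "w \<noteq> mat 1" using w(1) by (simp_all add: E_def)
    then show "det w = 1" "w$1$1 > 0" "w \<noteq> mat 1"
      using discrete_subgroup_SL[OF D, of w] unfolding near_def by (blast, linarith, blast)
  qed (intro comm xy)+
qed simp

abbreviation dg :: "real \<Rightarrow> real^2^2" where "dg l \<equiv> mk l 0 0 (1 / l)"

lemma conj_dg:
  "l \<noteq> 0 \<Longrightarrow> adj (dg l) ** mk a b c d ** dg l = mk a (b / l\<^sup>2) (c * l\<^sup>2) d"
  by (simp add: power2_eq_square)

text \<open>
  Along the geodesic \<open>l \<mapsto> dg l\<close> the group \<open>D\<close> is seen as its conjugate by \<open>dg l\<close>. Suppose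
  that, for large \<open>l\<close>, this conjugate has nontrivial elements arbitrarily close to the identity. The
  small elements at one scale commute, and those at scale \<open>l\<close> are still fairly small at scale
  \<open>2 l\<close>, so those found at all scales \<open>L k = l0 2\<^sup>k\<close> commute with one fixed \<open>x0\<close>. A matrix
  \<open>x = mk a b c d\<close> that commutes with \<open>x0 = mk p q r s\<close> has \<open>(a - d, b, c)\<close> parallel to
  \<open>(p - s, q, r)\<close>. At large scales \<open>a - d\<close> and \<open>c\<close> tend to 0. If \<open>r\<close> or \<open>p - s\<close> did not vanish,
  then so would \<open>b\<close>, and \<open>x\<close> would tend to the identity, which contradicts the discreteness of
  \<open>D\<close>.
\<close>
lemma unipotent_if_small_elements:
  assumes D: "discrete_subgroup D"
    and small: "\<And>\<epsilon>. \<epsilon> > 0 \<Longrightarrow> \<exists>l0. \<forall>l\<ge>l0. \<exists>x\<in>D. x \<noteq> mat 1 \<and> near \<epsilon> (adj (dg l) ** x ** dg l)"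
  shows "\<exists>s. s \<noteq> 0 \<and> mk 1 s 0 1 \<in> D"
proof -
  \<comment> \<open>passing from \<open>l\<close> to \<open>2 l\<close> enlarges an entry at most four times, and \<open>4/64 = 1/16\<close> is the bound
    below which elements commute\<close>
  obtain l1 where l1: "\<And>l. l \<ge> l1 \<Longrightarrow> \<exists>x\<in>D. x \<noteq> mat 1 \<and> near (1/64) (adj (dg l) ** x ** dg l)"
    using small[of "1/64"] by auto
  define l0 where "l0 = max l1 1"
  define L where "L k = l0 * 2 ^ k" for k :: nat
  have L: "L k \<ge> l1" "L k \<ge> 1" "L k > 0" "L (Suc k) = 2 * L k" for k
  proof -
    have "l0 * 1 \<le> L k" unfolding L_def by (intro mult_left_mono) (auto simp: l0_def)
    then show "L k \<ge> l1" "L k \<ge> 1" "L k > 0" by (auto simp: l0_def)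
  qed (auto simp: L_def)
  define good where
    "good k x \<longleftrightarrow> x \<in> D \<and> x \<noteq> mat 1 \<and> near (1/64) (adj (dg (L k)) ** x ** dg (L k))" for k x
  have ex: "\<exists>x. good k x" for k using l1[OF L(1)] by (auto simp: good_def)
  have SL: "x \<in> D \<Longrightarrow> det x = 1" for x using D by (rule discrete_subgroup_SL)
  have comm: "x ** y = y ** x"
    if "x \<in> D" "y \<in> D" "near (1/16) (adj (dg l) ** x ** dg l)"
      "near (1/16) (adj (dg l) ** y ** dg l)" "l > 0" for x y l
  proof -
    have l: "det (dg l) = 1" using that by simp
    have "(adj (dg l) ** x ** dg l) ** (adj (dg l) ** y ** dg l) =
        (adj (dg l) ** y ** dg l) ** (adj (dg l) ** x ** dg l)"
      using that l
      by (intro small_elements_commute[OF discrete_subgroup_conj[OF D l]] imageI)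
    then have "dg l ** (adj (dg l) ** (x ** y) ** dg l) ** adj (dg l) =
        dg l ** (adj (dg l) ** (y ** x) ** dg l) ** adj (dg l)"
      using mult_adj(3,4)[OF l] by (simp only: matrix_mul_assoc)
    then show ?thesis using mult_adj[OF l] by (simp only: matrix_mul_assoc)
  qed
  obtain x0 where x0: "good 0 x0" using ex by auto
  have comm0: "x ** x0 = x0 ** x" if "good k x" for x k
    using that
  proof (induction k arbitrary: x)
    case 0
    then show ?case using x0 L(3)[of 0]
      by (intro comm[of _ _ "L 0"]) (auto simp: good_def elim!: near_mono simp del: mk_mult adj_mk)
  next
    case (Suc k)
    obtain z where z: "good k z" using ex by auto
    obtain a b c d where z': "z = mk a b c d" by (cases z)
    have cz: "adj (dg l) ** z ** dg l = mk a (b / l\<^sup>2) (c * l\<^sup>2) d" if "l > 0" for l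
      using that unfolding z' by (intro conj_dg) auto
    have n: "\<bar>a - 1\<bar> < 1/64" "\<bar>b / (L k)\<^sup>2\<bar> < 1/64" "\<bar>c * (L k)\<^sup>2\<bar> < 1/64" "\<bar>d - 1\<bar> < 1/64"
      using z cz[OF L(3)[of k]] by (auto simp: good_def)
    moreover have q4: "\<bar>u - 1\<bar> < 1/64 \<Longrightarrow> \<bar>u - 1\<bar> < 1/16" "\<bar>u\<bar> < 1/64 \<Longrightarrow> \<bar>u / 4\<bar> < 1/16"
      "\<bar>u\<bar> < 1/64 \<Longrightarrow> \<bar>4 * u\<bar> < 1/16" for u :: real by auto
    moreover have scale: "b / (L (Suc k))\<^sup>2 = b / (L k)\<^sup>2 / 4"
      "c * (L (Suc k))\<^sup>2 = 4 * (c * (L k)\<^sup>2)"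
      by (simp_all add: L(4) power2_eq_square)
    ultimately have "near (1/16) (adj (dg (L (Suc k))) ** z ** dg (L (Suc k)))"
      unfolding cz[OF L(3)[of "Suc k"]] near_mk scale by (intro conjI q4 n)
    then have "x ** z = z ** x"
      using Suc.prems z L(3)[of "Suc k"]
      by (intro comm[of _ _ "L (Suc k)"]) (auto simp: good_def elim!: near_mono simp del: mk_mult adj_mk)
    moreover have "x0 ** z = z ** x0" using Suc.IH[OF z] by simp
    moreover have "a > 0" using n(1) by linarith
    then have "z$1$1 > 0" by (simp add: z')
    moreover have "det z = 1" "z \<noteq> mat 1" using z SL by (simp_all add: good_def)
    ultimately show ?case using commute_trans by metis
  qed
  obtain p q r s where x0': "x0 = mk p q r s" by (cases x0)
  obtain \<epsilon> where \<epsilon>: "\<epsilon> > 0" "\<And>A. A \<in> D \<Longrightarrow> near \<epsilon> A \<Longrightarrow> A = mat 1"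
    using discrete_subgroup_isolated[OF D] by blast
  have no: False if K: "\<And>a b c d x. x = mk a b c d \<Longrightarrow> x ** x0 = x0 ** x \<Longrightarrow>
      \<bar>b\<bar> \<le> K * (\<bar>a - d\<bar> + \<bar>c\<bar>)" "K > 0" for K
  proof -
    define \<eta> where "\<eta> = min (1/64) (min \<epsilon> (\<epsilon> / (3 * K)))"
    have "\<eta> \<le> \<epsilon> / (3 * K)" by (simp add: \<eta>_def)
    then have \<eta>: "\<eta> > 0" "\<eta> \<le> 1/64" "\<eta> \<le> \<epsilon>" "K * (3 * \<eta>) \<le> \<epsilon>"
      using \<epsilon>(1) K(2) by (auto simp: \<eta>_def pos_le_divide_eq mult_ac)
    obtain l2 where l2: "\<And>l. l \<ge> l2 \<Longrightarrow> \<exists>x\<in>D. x \<noteq> mat 1 \<and> near \<eta> (adj (dg l) ** x ** dg l)"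
      using small[OF \<eta>(1)] by auto
    obtain k where "l2 < 2 ^ k" using real_arch_pow[of 2 l2] by auto
    also have "1 * 2 ^ k \<le> L k" unfolding L_def by (intro mult_right_mono) (auto simp: l0_def)
    finally obtain x where x: "x \<in> D" "x \<noteq> mat 1" "near \<eta> (adj (dg (L k)) ** x ** dg (L k))"
      using l2[of "L k"] by auto
    then have "good k x" using \<eta>(2) by (auto simp: good_def elim: near_mono)
    then have c: "x ** x0 = x0 ** x" by (rule comm0)
    obtain a b c d where x': "x = mk a b c d" by (cases x)
    have n: "\<bar>a - 1\<bar> < \<eta>" "\<bar>c * (L k)\<^sup>2\<bar> < \<eta>" "\<bar>d - 1\<bar> < \<eta>"
      using x(3) L(3)[of k] conj_dg[of "L k" a b c d] by (auto simp: x' simp del: mk_mult adj_mk)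
    have "\<bar>c\<bar> * 1 \<le> \<bar>c\<bar> * (L k)\<^sup>2"
      using L(2) by (intro mult_left_mono one_le_power) auto
    then have n': "\<bar>c\<bar> < \<eta>" using n(2) by (simp add: abs_mult)
    have "\<bar>b\<bar> \<le> K * (\<bar>a - d\<bar> + \<bar>c\<bar>)" using K(1)[OF x' c] .
    also have "\<dots> < K * (3 * \<eta>)" using n n' K(2) by (intro mult_strict_left_mono) auto
    finally have "near \<epsilon> x" using n n' \<eta> by (auto simp: x')
    then show False using \<epsilon>(2) x by auto
  qed
  have "r = 0"
  proof (rule ccontr)
    assume r: "r \<noteq> 0"
    show False
    proof (rule no)
      fix a b c d x assume "x = mk a b c d" "x ** x0 = x0 ** x"
      then have "b * r = c * q" by (simp add: x0' commute_iff del: mk_mult)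
      then have "b = c * (q / r)" using r by (simp add: field_simps)
      then have "\<bar>b\<bar> = \<bar>q / r\<bar> * \<bar>c\<bar>" by (simp add: abs_mult)
      also have "\<dots> \<le> (\<bar>q / r\<bar> + 1) * (\<bar>a - d\<bar> + \<bar>c\<bar>)" by (intro mult_mono) auto
      finally show "\<bar>b\<bar> \<le> (\<bar>q / r\<bar> + 1) * (\<bar>a - d\<bar> + \<bar>c\<bar>)" .
    qed (simp add: add_nonneg_pos)
  qed
  moreover have "p = s"
  proof (rule ccontr)
    assume ps: "p \<noteq> s"
    show False
    proof (rule no)
      fix a b c d x assume "x = mk a b c d" "x ** x0 = x0 ** x"
      then have "(a - d) * q = (p - s) * b" by (simp add: x0' commute_iff del: mk_mult)
      then have "b = (a - d) * (q / (p - s))" using ps by (simp add: field_simps)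
      then have "\<bar>b\<bar> = \<bar>q / (p - s)\<bar> * \<bar>a - d\<bar>" by (simp add: abs_mult)
      also have "\<dots> \<le> (\<bar>q / (p - s)\<bar> + 1) * (\<bar>a - d\<bar> + \<bar>c\<bar>)" by (intro mult_mono) auto
      finally show "\<bar>b\<bar> \<le> (\<bar>q / (p - s)\<bar> + 1) * (\<bar>a - d\<bar> + \<bar>c\<bar>)" .
    qed (simp add: add_nonneg_pos)
  qed
  moreover have "\<bar>p - 1\<bar> < 1/64"
    using x0 L(3)[of 0] conj_dg[of "L 0" p q r s]
    by (auto simp: good_def x0' simp del: mk_mult adj_mk)
  then have "p > 0" by linarith
  moreover have "p * s - q * r = 1" using x0 SL[of x0] by (auto simp: good_def x0')
  ultimately have "x0 = mk 1 q 0 1" by (auto simp: x0' power2_eq_square[symmetric] power2_eq_1_iff)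
  moreover from this have "q \<noteq> 0" using x0 by (auto simp: good_def mat_1_mk)
  ultimately show ?thesis using x0 by (auto simp: good_def)
qed

section \<open>Invariant measures and ergodicity of the horocycle flow\<close>

text \<open>
  Right multiplication by \<open>up s\<close> is the horocycle flow, and by \<open>dg l\<close> the geodesic flow.
\<close>
abbreviation up :: "real \<Rightarrow> real^2^2" where "up s \<equiv> mk 1 s 0 1"

abbreviation rt :: "(real^2^2) set \<Rightarrow> real^2^2 \<Rightarrow> (real^2^2) set" where
  "rt S h \<equiv> (\<lambda>A. A ** h) ` S"

lemma mem_rt:
  assumes "S \<subseteq> SL" "det h = 1"
  shows "A \<in> rt S h \<longleftrightarrow> det A = 1 \<and> A ** adj h \<in> S"
  using right_image_eq[OF assms] by auto

lemma rt_rt: "rt (rt S h) h' = rt S (h ** h')"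
  by (simp add: image_image matrix_mul_assoc)

lemma rt_Diff:
  assumes "det h = 1"
  shows "rt (S - T) h = rt S h - rt T h"
proof -
  have "inj (\<lambda>A :: real^2^2. A ** h)"
    by (rule injI, drule arg_cong[of _ _ "\<lambda>A. A ** adj h"]) (simp add: assms)
  then show ?thesis by (rule image_set_diff)
qed

lemma openSL_rt:
  assumes "openSL S" "det h = 1"
  shows "openSL (rt S h)"
proof -
  have "S \<subseteq> SL" using openin_subset[OF assms(1)] by simp
  then show ?thesis
    using assms right_image_eq[of S h] openSL_right_translate[OF assms(1), of "adj h"] by simp
qed

text \<open>
  The left invariant sets are the preimages of the subsets of the quotient \<open>D\<setminus>SL\<close>.
\<close>
definition left_inv :: "(real^2^2) set \<Rightarrow> (real^2^2) set \<Rightarrow> bool" where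
  "left_inv D S \<longleftrightarrow> S \<subseteq> SL \<and> (\<forall>L\<in>D. \<forall>A\<in>S. L ** A \<in> S)"

lemma left_inv_rt: "left_inv D S \<Longrightarrow> det h = 1 \<Longrightarrow> left_inv D (rt S h)"
  unfolding left_inv_def by (auto simp: det_mul matrix_mul_assoc)

lemma left_inv_UN: "(\<And>i. i \<in> I \<Longrightarrow> left_inv D (S i)) \<Longrightarrow> left_inv D (\<Union>i\<in>I. S i)"
  unfolding left_inv_def by blast

lemma left_inv_compl:
  assumes "left_inv D S" and D: "\<And>L. L \<in> D \<Longrightarrow> det L = 1 \<and> adj L \<in> D"
  shows "left_inv D (SL - S)"
  unfolding left_inv_def
proof (intro conjI ballI)
  fix L A assume L: "L \<in> D" and A: "A \<in> SL - S"
  have "A \<in> S" if "L ** A \<in> S"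
  proof -
    have "adj L ** (L ** A) \<in> S" using that assms(1) D[OF L] unfolding left_inv_def by blast
    then show ?thesis using D[OF L] by simp
  qed
  with D[OF L] A show "L ** A \<in> SL - S" by (auto simp: det_mul)
qed auto

text \<open>
  A finite measure on the quotient \<open>D\<setminus>SL\<close> that is invariant under right translations is described
  by its pullback to \<open>SL\<close>. Only left invariant open sets have to be measurable: the \<open>\<sigma>\<close>-algebra that
  they generate is the one of the quotient, and on it the measure is finite.
\<close>
locale lattice_measure = finite_measure \<mu> for \<mu> :: "(real^2^2) measure" +
  fixes D :: "(real^2^2) set"
  assumes discrete: "discrete_subgroup D"
    and space: "space \<mu> = SL"
    and open_sets: "openSL U \<Longrightarrow> left_inv D U \<Longrightarrow> U \<in> sets \<mu>"
    and nonzero: "emeasure \<mu> SL \<noteq> 0"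
    and rt_sets: "S \<in> sets \<mu> \<Longrightarrow> det h = 1 \<Longrightarrow> rt S h \<in> sets \<mu>"
    and emeasure_rt: "S \<in> sets \<mu> \<Longrightarrow> det h = 1 \<Longrightarrow> emeasure \<mu> (rt S h) = emeasure \<mu> S"
begin

lemma measure_rt: "S \<in> sets \<mu> \<Longrightarrow> det h = 1 \<Longrightarrow> measure \<mu> (rt S h) = measure \<mu> S"
  by (simp add: measure_def emeasure_rt)

lemma left_inv_Diff: "left_inv D S \<Longrightarrow> left_inv D (SL - S)"
  using discrete discrete_subgroup_SL discrete_subgroup_closed(3) by (intro left_inv_compl) blast+

text \<open>
  The translates of an open set \<open>U\<close> cover \<open>SL\<close>, and countably many of them suffice because \<open>SL\<close>
  is a Lindelof space.
\<close>
lemma null_if_translates_null: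
  assumes U: "openSL U" "U \<noteq> {}" and S: "S \<in> sets \<mu>" "S \<subseteq> SL"
    and Uinv: "left_inv D U"
    and null: "\<And>h. det h = 1 \<Longrightarrow> measure \<mu> (S \<inter> rt U h) = 0"
  shows "measure \<mu> S = 0"
proof -
  have USL: "U \<subseteq> SL" using openin_subset[OF U(1)] by simp
  define \<F> where "\<F> = {rt U h |h. det h = 1}"
  obtain \<F>' where F': "\<F>' \<subseteq> \<F>" "countable \<F>'" "\<Union>\<F>' = \<Union>\<F>"
  proof (rule Lindelof_openin[of \<F> SL])
    show "openSL T" if "T \<in> \<F>" for T using that openSL_rt[OF U(1)] by (auto simp: \<F>_def)
  qed
  obtain B where B: "B \<in> U" using U by auto
  have "A \<in> \<Union>\<F>" if "det A = 1" for A
  proof -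
    have "det (adj B ** A) = 1" using B USL that by (auto simp: det_mul)
    moreover have "A \<in> rt U (adj B ** A)"
      using B USL that by (intro image_eqI[of _ _ B]) (auto simp: matrix_mul_assoc)
    ultimately show ?thesis unfolding \<F>_def by blast
  qed
  then have "S \<subseteq> \<Union>\<F>'" using S(2) unfolding F'(3) by blast
  then have "S = (\<Union>T\<in>\<F>'. S \<inter> T)" by blast
  moreover have "(\<Union>T\<in>\<F>'. S \<inter> T) \<in> null_sets \<mu>"
  proof (rule null_sets_UN'[OF F'(2)])
    fix T assume "T \<in> \<F>'"
    then obtain h where h: "T = rt U h" "det h = 1" using F' by (auto simp: \<F>_def)
    have "S \<inter> T \<in> sets \<mu>"
      using h S open_sets[OF openSL_rt[OF U(1) h(2)] left_inv_rt[OF Uinv h(2)]] by auto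
    then show "S \<inter> T \<in> null_sets \<mu>"
      using null[OF h(2)] h(1) by (auto simp: null_sets_def emeasure_eq_measure)
  qed
  ultimately show ?thesis by (metis measure_eq_0_null_sets)
qed

lemma measure_open_pos:
  assumes "openSL U" "U \<noteq> {}" "left_inv D U"
  shows "measure \<mu> U > 0"
proof (rule ccontr)
  assume "\<not> ?thesis"
  then have 0: "measure \<mu> U = 0" using measure_nonneg[of \<mu> U] by linarith
  have "measure \<mu> SL = 0"
  proof (rule null_if_translates_null[OF assms(1,2)])
    show "SL \<in> sets \<mu>" using space by (metis sets.top)
    fix h :: "real^2^2" assume h: "det h = 1"
    have "SL \<inter> rt U h = rt U h" using assms(3) h by (auto simp: left_inv_def det_mul)
    then show "measure \<mu> (SL \<inter> rt U h) = 0"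
      using measure_rt[OF open_sets[OF assms(1,3)] h] 0 by simp
  qed (use assms in auto)
  then show False using nonzero by (simp add: emeasure_eq_measure)
qed

text \<open>
  Ergodicity of the horocycle flow, for closed sets. This is the Mautner phenomenon: the quantity
  \<open>e h = \<mu> (F h - F)\<close> is subadditive in \<open>h\<close>, and it does not change when \<open>h\<close> is multiplied on either
  side by upper unipotent matrices, so that for \<open>c \<noteq> 0\<close> it depends on the lower left entry \<open>c\<close> of
  \<open>h\<close> only. It tends to 0 as \<open>h\<close> tends to the identity, as \<open>F\<close> is the intersection of its
  neighbourhoods. The lower unipotent matrix with entry \<open>c\<close> is a product of two matrices whose
  lower left entries are as small as one likes, so \<open>e\<close> vanishes identically. Then \<open>F\<close> meets each translate of
  its complement in a null set.
\<close>
lemma horocycle_ergodic: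
  assumes F: "left_inv D F" "openSL (SL - F)" "F \<noteq> SL" and N: "\<And>s. rt F (up s) = F"
  shows "measure \<mu> F = 0"
proof -
  have FSL: "F \<subseteq> SL" using F(1) by (simp add: left_inv_def)
  have Osets: "SL - F \<in> sets \<mu>" using F(2) left_inv_Diff[OF F(1)] by (rule open_sets)
  have "F = space \<mu> - (SL - F)" using FSL space by auto
  then have Fsets: "F \<in> sets \<mu>" using Osets by (metis sets.compl_sets)
  define e where "e h = measure \<mu> (rt F h - F)" for h
  have diff_sets: "rt F h - F \<in> sets \<mu>" if "det h = 1" for h
    using that Fsets rt_sets by auto
  have cont: "\<exists>\<delta>>0. \<forall>h. det h = 1 \<longrightarrow> near \<delta> h \<longrightarrow> e h < \<epsilon>" if \<epsilon>: "\<epsilon> > 0" for \<epsilon>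
  proof -
    \<comment> \<open>the thickening of \<open>F\<close> by the right action of a neighbourhood of the identity\<close>
    define T where "T k = (\<Union>A\<in>F. {C \<in> SL. adj A ** C \<in> {X \<in> SL. near (1 / Suc k) X}})" for k :: nat
    have T_open: "openSL (T k)" for k
    proof -
      have "openSL {C \<in> SL. adj A ** C \<in> {X \<in> SL. near (1 / Suc k) X}}" if "A \<in> F" for A
        using FSL that by (intro openSL_left_translate openSL_near) auto
      then show ?thesis unfolding T_def by blast
    qed
    have T_inv: "left_inv D (T k)" for k
      unfolding left_inv_def
    proof (intro conjI ballI)
      fix L C assume L: "L \<in> D" and "C \<in> T k"
      then obtain A where A: "A \<in> F" "C \<in> SL" "adj A ** C \<in> SL" "near (1 / Suc k) (adj A ** C)"
        by (auto simp: T_def)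
      have dL: "det L = 1" using L discrete discrete_subgroup_SL by blast
      have "L ** A \<in> F" using F(1) L A by (simp add: left_inv_def)
      moreover have "adj (L ** A) ** (L ** C) = adj A ** C"
        using dL by (simp add: adj_mult matrix_mul_assoc)
      ultimately show "L ** C \<in> T k" using A dL unfolding T_def
        by (intro UN_I[of "L ** A"]) (simp_all add: det_mul)
    qed (auto simp: T_def)
    have T_sets: "range T \<subseteq> sets \<mu>" using open_sets[OF T_open T_inv] by auto
    have "decseq T"
      unfolding decseq_Suc_iff T_def
      by (auto elim!: near_mono intro!: bexI simp: field_simps)
    moreover have "(\<Inter>k. T k) = F"
    proof (intro equalityI subsetI)
      fix C assume C: "C \<in> (\<Inter>k. T k)"
      then have dC: "C \<in> SL" by (auto simp: T_def)
      show "C \<in> F"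
      proof (rule ccontr)
        assume "C \<notin> F"
        then obtain \<delta> where \<delta>: "0 < \<delta>" "\<And>A. A \<in> SL \<Longrightarrow> near \<delta> A \<Longrightarrow> C ** A \<in> SL - F"
          using ex_near[OF F(2), of C] dC by blast
        obtain k :: nat where k: "1 / Suc k < \<delta>"
          using \<delta>(1) nat_approx_posE by blast
        obtain A where A: "A \<in> F" "adj A ** C \<in> SL" "near (1 / Suc k) (adj A ** C)"
          using C by (auto simp: T_def)
        have "near \<delta> (adj (adj A ** C))" using A(3) k by (simp add: near_mono)
        then have "C ** adj (adj A ** C) \<in> SL - F"
          using A(2) by (intro \<delta>(2)) auto
        moreover have "C ** adj (adj A ** C) = A"
          using dC by (simp add: adj_mult)
        ultimately show False using A(1) by simp
      qed
    next
      fix C assume "C \<in> F"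
      then show "C \<in> (\<Inter>k. T k)" using FSL unfolding T_def by (auto intro!: bexI[of _ C])
    qed
    ultimately have "(\<lambda>k. measure \<mu> (T k)) \<longlonglongrightarrow> measure \<mu> F"
      using finite_Lim_measure_decseq[OF T_sets] by simp
    then have "eventually (\<lambda>k. measure \<mu> (T k) < measure \<mu> F + \<epsilon>) sequentially"
      using \<epsilon> by (intro order_tendstoD) auto
    then obtain k where k: "measure \<mu> (T k) < measure \<mu> F + \<epsilon>"
      by (auto simp: eventually_sequentially)
    have "e h < \<epsilon>" if h: "det h = 1" "near (1 / Suc k) h" for h
    proof -
      have "A ** h \<in> T k" if "A \<in> F" for A
      proof -
        have "det A = 1" using FSL that by auto
        then show ?thesis
          unfolding T_def using that h by (intro UN_I[of A]) (simp_all add: det_mul)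
      qed
      then have "rt F h \<subseteq> T k" by blast
      then have "e h \<le> measure \<mu> (T k - F)"
        unfolding e_def using T_sets Fsets by (intro finite_measure_mono) auto
      also have "F \<subseteq> T k" using \<open>(\<Inter>k. T k) = F\<close> by blast
      then have "measure \<mu> (T k - F) = measure \<mu> (T k) - measure \<mu> F"
        using T_sets Fsets by (intro finite_measure_Diff) auto
      finally show ?thesis using k by simp
    qed
    then show ?thesis by (intro exI[of _ "1 / Suc k"]) auto
  qed
  have biinv: "e (up a ** h ** up b) = e h" if h: "det h = 1" for a b h
  proof -
    have "rt F (up a ** h ** up b) = rt (rt (rt F (up a)) h) (up b)"
      by (simp only: image_image matrix_mul_assoc)
    then have "rt F (up a ** h ** up b) - F = rt (rt F h) (up b) - rt F (up b)"
      by (simp only: N)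
    also have "\<dots> = rt (rt F h - F) (up b)" by (subst rt_Diff) (simp_all only: N, simp)
    finally show ?thesis using measure_rt[OF diff_sets[OF h]] by (simp add: e_def)
  qed
  have subadd: "e (h ** h') \<le> e h + e h'" if h: "det h = 1" "det h' = 1" for h h'
  proof -
    have "rt F (h ** h') - F \<subseteq> rt (rt F h - F) h' \<union> (rt F h' - F)"
      by (simp only: rt_rt[symmetric] rt_Diff[OF h(2)]) auto
    then have "e (h ** h') \<le> measure \<mu> (rt (rt F h - F) h' \<union> (rt F h' - F))"
      unfolding e_def using h diff_sets rt_sets by (intro finite_measure_mono) auto
    also have "\<dots> \<le> measure \<mu> (rt (rt F h - F) h') + e h'"
      unfolding e_def using h diff_sets rt_sets by (intro measure_Un_le) auto
    finally show ?thesis using measure_rt[OF diff_sets] h by (simp add: e_def)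
  qed
  have e_lower_left: "e (mk a b c d) = e (mk 1 0 c 1)" if "c \<noteq> 0" "a * d - b * c = 1" for a b c d
  proof -
    have b: "b = (a * d - 1) / c" using that by (simp add: field_simps)
    have eq: "mk a b c d = up ((a - 1) / c) ** mk 1 0 c 1 ** up ((d - 1) / c)"
      unfolding mk_mult mk_eq_iff b using that(1) by (simp add: field_simps)
    show ?thesis unfolding eq by (rule biinv) simp
  qed
  have e_lower: "e (mk 1 0 c 1) = 0" if c: "c \<noteq> 0" for c
  proof -
    have "e (mk 1 0 c 1) \<le> \<epsilon>" if "\<epsilon> > 0" for \<epsilon>
    proof -
      obtain \<delta> where \<delta>: "\<delta> > 0" "\<And>h. det h = 1 \<Longrightarrow> near \<delta> h \<Longrightarrow> e h < \<epsilon> / 2"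
        using cont[of "\<epsilon>/2"] \<open>\<epsilon> > 0\<close> by auto
      define r where "r = \<delta> / 2"
      define l where "l = 2 * r / c"
      have l: "l \<noteq> 0" "r > 0" using \<delta>(1) c by (auto simp: l_def r_def)
      \<comment> \<open>the factors need not be close to the identity, since \<open>e\<close> depends only on their entry \<open>r\<close>\<close>
      have "mk 1 0 c 1 = mk l 0 r (1/l) ** mk (1/l) 0 r l"
        using l c by (simp add: l_def)
      then have "e (mk 1 0 c 1) \<le> e (mk l 0 r (1/l)) + e (mk (1/l) 0 r l)"
        using subadd[of "mk l 0 r (1/l)" "mk (1/l) 0 r l"] l by simp
      also have "\<dots> = e (mk 1 0 r 1) + e (mk 1 0 r 1)"
        using e_lower_left[of r l "1/l" 0] e_lower_left[of r "1/l" l 0] l by simp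
      also have "\<dots> \<le> \<epsilon>" using \<delta>(2)[of "mk 1 0 r 1"] \<delta>(1) by (simp add: r_def)
      finally show ?thesis .
    qed
    then have "e (mk 1 0 c 1) \<le> 0" by (rule field_le_epsilon) simp
    then show ?thesis by (simp add: e_def measure_le_0_iff)
  qed
  have e0: "e h = 0" if "det h = 1" for h
  proof -
    obtain a b c d where h: "h = mk a b c d" by (cases h)
    show ?thesis
    proof (cases "c = 0")
      case False
      then show ?thesis using e_lower_left[of c a d b] e_lower[of c] that by (simp add: h)
    next
      case True
      then have ad: "a * d = 1" using that by (simp add: h)
      have d: "d \<noteq> 0" using ad by auto
      have "h = mk (a + b) b d d ** mk 1 0 (-1) 1" using True by (simp add: h)
      then have "e h \<le> e (mk (a + b) b d d) + e (mk 1 0 (-1) 1)"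
        using subadd[of "mk (a + b) b d d" "mk 1 0 (-1) 1"] ad by (simp add: algebra_simps)
      also have "\<dots> = 0"
        using e_lower_left[of d "a + b" d b] e_lower[of d] e_lower[of "-1"] d ad
        by (simp add: algebra_simps)
      finally show ?thesis by (simp add: e_def measure_le_0_iff)
    qed
  qed
  show ?thesis
  proof (rule null_if_translates_null[OF F(2) _ Fsets FSL left_inv_Diff[OF F(1)]])
    show "SL - F \<noteq> {}" using F(3) FSL by auto
    fix h :: "real^2^2" assume h: "det h = 1"
    have "F \<inter> rt (SL - F) h = rt (rt F (adj h) - F) h"
    proof -
      have "rt SL h = SL" using right_image_eq[of SL h] h by (auto simp: det_mul)
      moreover have "rt (rt F (adj h)) h = F" using h by (simp add: rt_rt)
      ultimately show ?thesis using rt_Diff[OF h] FSL by auto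
    qed
    then show "measure \<mu> (F \<inter> rt (SL - F) h) = 0"
      using measure_rt[OF diff_sets, of "adj h" h] e0[of "adj h"] h by (simp add: e_def)
  qed
qed

text \<open>
  The complement of the full horocyclic saturation of \<open>V\<close> is closed and invariant, so by ergodicity
  it is null. Bounded horocycle times already fill most of the space by continuity of the measure.
\<close>
lemma horocycle_saturation_large:
  assumes V: "openSL V" "left_inv D V" "V \<noteq> {}" and \<epsilon>: "\<epsilon> > 0"
  shows "\<exists>L>0. measure \<mu> SL - \<epsilon> < measure \<mu> (\<Union>s\<in>{-L<..<L}. rt V (up s))"
proof -
  have VSL: "V \<subseteq> SL" using V(2) by (simp add: left_inv_def)
  define W where "W k = (\<Union>s\<in>{- real (Suc k)<..<real (Suc k)}. rt V (up s))" for k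
  have op: "openSL (\<Union>s\<in>I. rt V (up s))" "left_inv D (\<Union>s\<in>I. rt V (up s))" for I
    using V(1,2) by (auto intro!: openSL_rt left_inv_UN left_inv_rt)
  have W_sets: "range W \<subseteq> sets \<mu>" using open_sets[OF op] by (auto simp: W_def)
  define Vsat where "Vsat = (\<Union>s. rt V (up s))"
  have Vsat: "openSL Vsat" "left_inv D Vsat" unfolding Vsat_def using op by auto
  have OSL: "Vsat \<subseteq> SL" using Vsat(2) by (simp add: left_inv_def)
  have "incseq W" unfolding incseq_Suc_iff W_def by fastforce
  moreover have "(\<Union>k. W k) = Vsat"
  proof -
    have "\<exists>k. s \<in> {- real (Suc k)<..<real (Suc k)}" for s
    proof -
      obtain n where "\<bar>s\<bar> < real n" using reals_Archimedean2 by blast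
      then show ?thesis by (intro exI[of _ n]) auto
    qed
    then show ?thesis unfolding W_def Vsat_def by blast
  qed
  ultimately have lim: "(\<lambda>k. measure \<mu> (W k)) \<longlonglongrightarrow> measure \<mu> Vsat"
    using finite_Lim_measure_incseq[OF W_sets] by simp
  have "measure \<mu> (SL - Vsat) = 0"
  proof (rule horocycle_ergodic)
    show "left_inv D (SL - Vsat)" using left_inv_Diff[OF Vsat(2)] .
    have "SL - (SL - Vsat) = Vsat" using OSL by auto
    then show "openSL (SL - (SL - Vsat))" using Vsat(1) by simp
    have "rt V (up 0) \<subseteq> Vsat" unfolding Vsat_def by blast
    then have "Vsat \<noteq> {}" using V(3) by auto
    then show "SL - Vsat \<noteq> SL" using OSL by auto
    fix s
    have "rt Vsat (up s) = (\<Union>t. rt V (up (t + s)))"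
      by (simp add: Vsat_def image_UN rt_rt add.commute)
    also have "\<dots> = (\<Union>t\<in>range (\<lambda>t. t + s). rt V (up t))" by blast
    also have "range (\<lambda>t. t + s) = UNIV" by (rule surj_plus_right)
    also have "(\<Union>t\<in>UNIV. rt V (up t)) = Vsat" by (simp add: Vsat_def)
    finally have "rt Vsat (up s) = Vsat" .
    moreover have "rt SL (up s) = SL" using right_image_eq[of SL "up s"] by (auto simp: det_mul)
    ultimately show "rt (SL - Vsat) (up s) = SL - Vsat" by (subst rt_Diff) auto
  qed
  moreover have "SL \<in> sets \<mu>" using space by (metis sets.top)
  ultimately have "measure \<mu> Vsat = measure \<mu> SL"
    using finite_measure_Diff[of SL Vsat] open_sets[OF Vsat] OSL by simp
  then have "eventually (\<lambda>k. measure \<mu> SL - \<epsilon> < measure \<mu> (W k)) sequentially"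
    using lim \<epsilon> by (intro order_tendstoD) auto
  then obtain k where "measure \<mu> SL - \<epsilon> < measure \<mu> (W k)"
    by (auto simp: eventually_sequentially)
  then show ?thesis by (intro exI[of _ "real (Suc k)"]) (auto simp: W_def)
qed

end

section \<open>The measure of thin tubes around horocycles\<close>

lemma left_translate_openSL:
  assumes "openSL S" "det L = 1"
  shows "openSL ((\<lambda>A. L ** A) ` S)"
proof -
  have "S \<subseteq> SL" using openin_subset[OF assms(1)] by simp
  then show ?thesis
    using assms left_image_eq[of S L] openSL_left_translate[OF assms(1), of "adj L"] by simp
qed

lemma openSL_entries:
  "openSL {A \<in> SL. \<bar>A$1$1 - 1\<bar> < a \<and> \<bar>A$2$1\<bar> < b \<and> \<bar>A$1$2\<bar> < c * A$1$1}"
proof -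
  have "open {A :: real^2^2. \<bar>A$1$1 - 1\<bar> < a \<and> \<bar>A$2$1\<bar> < b \<and> \<bar>A$1$2\<bar> < c * A$1$1}"
    by (intro open_Collect_conj open_Collect_less continuous_intros)
  then show ?thesis unfolding openin_open by blast
qed

text \<open>
  Up to constants these sets are boxes in the coordinates of the Bruhat decomposition into a lower
  unipotent, a diagonal and an upper unipotent factor. Multiplication by \<open>up s\<close> from the right fixes
  the first column and adds \<open>s\<close> to \<open>A$1$2 / A$1$1\<close>, which is why the last condition is relative to
  \<open>A$1$1\<close>.
\<close>
definition entry_box :: "real \<Rightarrow> real \<Rightarrow> real \<Rightarrow> (real^2^2) set" where
  "entry_box a b c = {A \<in> SL. \<bar>A$1$1 - 1\<bar> < a \<and> \<bar>A$2$1\<bar> < b \<and> \<bar>A$1$2\<bar> < c * A$1$1}"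

lemma openSL_entry_box: "openSL (entry_box a b c)"
  unfolding entry_box_def by (rule openSL_entries)

lemma entry_box_subset_SL: "entry_box a b c \<subseteq> SL"
  by (auto simp: entry_box_def)

lemma mk_in_entry_box:
  "mk p q r s \<in> entry_box a b c \<longleftrightarrow> p * s - q * r = 1 \<and> \<bar>p - 1\<bar> < a \<and> \<bar>r\<bar> < b \<and> \<bar>q\<bar> < c * p"
  by (simp add: entry_box_def)

lemma entry_box_near:
  assumes "A \<in> entry_box k k k" "k \<le> 1/4"
  shows "near (3 * k) A"
proof -
  obtain p q r s where A: "A = mk p q r s" by (cases A)
  have h: "p * s - q * r = 1" "\<bar>p - 1\<bar> < k" "\<bar>r\<bar> < k" "\<bar>q\<bar> < k * p"
    using assms(1) by (simp_all add: A mk_in_entry_box)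
  have k: "k > 0" using h(2) by linarith
  have p: "3/4 < p" "p < 5/4" using h(2) assms(2) by linarith+
  have "k * p \<le> k * (5/4)" using p k by (intro mult_left_mono) auto
  then have q: "\<bar>q\<bar> < 5/4 * k" using h(4) by simp
  have "\<bar>q * r\<bar> \<le> (5/4 * k) * (1/4)"
    unfolding abs_mult using q h(3) assms(2) by (intro mult_mono) auto
  then have qr: "\<bar>q * r\<bar> \<le> 5/16 * k" by simp
  have "\<bar>p * (s - 1)\<bar> = \<bar>q * r - (p - 1)\<bar>" using h(1) by (simp add: algebra_simps)
  also have "\<dots> < 21/16 * k" using qr h(2) by linarith
  finally have "p * \<bar>s - 1\<bar> < 21/16 * k" using p by (simp add: abs_mult)
  moreover have "3/4 * \<bar>s - 1\<bar> \<le> p * \<bar>s - 1\<bar>" using p by (intro mult_right_mono) auto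
  ultimately have "3/4 * \<bar>s - 1\<bar> < 21/16 * k" by (rule order.strict_trans1[rotated])
  then have "\<bar>s - 1\<bar> < 3 * k" using k by simp
  then show ?thesis using h q k by (simp add: A)
qed

lemma conj_entry_box:
  assumes "A \<in> entry_box k (k / l\<^sup>2) (k * l\<^sup>2)" "l > 0"
  shows "adj (dg l) ** A ** dg l \<in> entry_box k k k"
proof -
  obtain p q r s where A: "A = mk p q r s" by (cases A)
  have h: "p * s - q * r = 1" "\<bar>p - 1\<bar> < k" "\<bar>r\<bar> < k / l\<^sup>2" "\<bar>q\<bar> < k * l\<^sup>2 * p"
    using assms(1) by (simp_all add: A mk_in_entry_box)
  have l: "l\<^sup>2 > 0" using assms by simp
  have "\<bar>r\<bar> * l\<^sup>2 < k" using h(3) l by (simp add: pos_less_divide_eq)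
  moreover have "\<bar>q\<bar> / l\<^sup>2 < k * p" using h(4) l by (simp add: pos_divide_less_eq mult_ac)
  moreover have "p * s - (q / l\<^sup>2) * (r * l\<^sup>2) = 1" using h(1) l by simp
  ultimately have "mk p (q / l\<^sup>2) (r * l\<^sup>2) s \<in> entry_box k k k"
    using h by (simp add: mk_in_entry_box abs_mult)
  then show ?thesis unfolding A using assms(2) by (subst conj_dg) auto
qed

context lattice_measure
begin

definition sat :: "(real^2^2) set \<Rightarrow> (real^2^2) set" where
  "sat S = (\<Union>L\<in>D. (\<lambda>A. L ** A) ` S)"

lemma D_SL: "L \<in> D \<Longrightarrow> det L = 1"
  using discrete discrete_subgroup_SL by blast

lemma left_inv_sat:
  assumes "S \<subseteq> SL" shows "left_inv D (sat S)"
proof -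
  have "L ** (K ** A) \<in> sat S" if "L \<in> D" "K \<in> D" "A \<in> S" for L K A
    unfolding sat_def using that discrete_subgroup_closed(2)[OF discrete, of L K]
    by (intro UN_I[of "L ** K"] image_eqI[of _ _ A]) (auto simp: matrix_mul_assoc)
  moreover have "sat S \<subseteq> SL" unfolding sat_def using assms D_SL by (auto simp: det_mul)
  ultimately show ?thesis unfolding left_inv_def by (auto simp: sat_def)
qed

lemma openSL_sat: "openSL S \<Longrightarrow> openSL (sat S)"
  unfolding sat_def using D_SL by (blast intro: left_translate_openSL)

lemma subset_sat: "S \<subseteq> sat S"
  unfolding sat_def using discrete_subgroup_closed(1)[OF discrete] by force

text \<open>
  The measure of a box is at least proportional to its thickness \<open>\<eta>\<close> in the direction of the
  opposite horocycles. Indeed a box of fixed size is covered by about \<open>1 / \<eta>\<close> translates of the thin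
  box by lower unipotent matrices, and it has positive measure. This comparison replaces any appeal
  to the uniqueness of Haar measure.
\<close>
lemma measure_flow_box_lower:
  assumes g: "det g = 1" and k: "0 < k" "k \<le> 1/4"
  shows "\<exists>c>0. \<forall>\<eta>. 0 < \<eta> \<longrightarrow> \<eta> \<le> k/8 \<longrightarrow> c * \<eta> \<le> measure \<mu> (sat ((\<lambda>A. g ** A) ` entry_box k \<eta> (1/2)))"
proof -
  let ?R = "sat ((\<lambda>A. g ** A) ` entry_box (k/2) (k/16) (1/4))"
  let ?Q = "\<lambda>\<eta>. sat ((\<lambda>A. g ** A) ` entry_box k \<eta> (1/2))"
  have op: "openSL (sat ((\<lambda>A. g ** A) ` entry_box a b c))" for a b c
    by (intro openSL_sat left_translate_openSL openSL_entry_box g)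
  have inv: "left_inv D (sat ((\<lambda>A. g ** A) ` entry_box a b c))" for a b c
    using g entry_box_subset_SL by (intro left_inv_sat) (fastforce simp: det_mul)
  note sets = open_sets[OF op inv]
  have "mat 1 \<in> entry_box (k/2) (k/16) (1/4)" using k by (simp add: mat_1_mk mk_in_entry_box)
  then have "?R \<noteq> {}" using subset_sat by blast
  then have pos: "measure \<mu> ?R > 0" by (rule measure_open_pos[OF op _ inv])
  have "measure \<mu> ?R * \<eta> \<le> measure \<mu> (?Q \<eta>)" if \<eta>: "0 < \<eta>" "\<eta> \<le> k/8" for \<eta>
  proof -
    define J where "J = \<lfloor>k / (2 * \<eta>)\<rfloor>"
    have J0: "J \<ge> 0" using k \<eta> by (simp add: J_def)
    have cover: "\<exists>j\<in>{-J..J}. A ** mk 1 0 (j * \<eta>) 1 \<in> entry_box k \<eta> (1/2)"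
      if A: "A \<in> entry_box (k/2) (k/16) (1/4)" for A
    proof -
      obtain p q r s where A': "A = mk p q r s" by (cases A)
      have h: "p * s - q * r = 1" "\<bar>p - 1\<bar> < k/2" "\<bar>r\<bar> < k/16" "\<bar>q\<bar> < p/4"
        using A by (simp_all add: A' mk_in_entry_box)
      have p: "7/8 < p" "p < 9/8" using h(2) k by linarith+
      have "\<bar>q * r\<bar> \<le> 1 * (1/64)"
        unfolding abs_mult using h p k by (intro mult_mono) auto
      then have "63/64 \<le> p * s" "p * s \<le> 65/64" using h(1) by linarith+
      then have s: "1/2 < s" "s < 2"
      proof -
        have "\<not> s \<le> 1/2"
        proof
          assume "s \<le> 1/2"
          then have "p * s \<le> p * (1/2)" using p by (intro mult_left_mono) auto
          then show False using \<open>63/64 \<le> p * s\<close> p by linarith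
        qed
        moreover have "\<not> s \<ge> 2"
        proof
          assume "s \<ge> 2"
          then have "p * 2 \<le> p * s" using p by (intro mult_left_mono) auto
          then show False using \<open>p * s \<le> 65/64\<close> p by linarith
        qed
        ultimately show "1/2 < s" "s < 2" by auto
      qed
      \<comment> \<open>right translation by \<open>z\<close> turns the lower left entry into \<open>r + z s\<close>; \<open>z\<close> is the multiple of
        \<open>\<eta>\<close> that makes it smallest\<close>
      define j where "j = round (- r / (s * \<eta>))"
      define z where "z = j * \<eta>"
      have "\<bar>j - (- r / (s * \<eta>))\<bar> \<le> 1/2" unfolding j_def by (rule of_int_round_abs_le)
      then have "\<bar>j - (- r / (s * \<eta>))\<bar> * (s * \<eta>) \<le> 1/2 * (s * \<eta>)"
        using s \<eta> by (intro mult_right_mono) auto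
      also have "\<bar>j - (- r / (s * \<eta>))\<bar> * (s * \<eta>) = \<bar>(j - (- r / (s * \<eta>))) * (s * \<eta>)\<bar>"
        using s \<eta> by (simp add: abs_mult)
      also have "(j - (- r / (s * \<eta>))) * (s * \<eta>) = r + z * s"
        using s \<eta> by (simp add: z_def field_simps)
      finally have rz: "\<bar>r + z * s\<bar> \<le> 1/2 * s * \<eta>" by simp
      have "1/2 * s * \<eta> < \<eta>" using s \<eta> by simp
      then have rz': "\<bar>r + z * s\<bar> < \<eta>" using rz by linarith
      have "\<bar>z\<bar> * (1/2) \<le> \<bar>z\<bar> * s" using s by (intro mult_left_mono) auto
      also have "\<dots> = \<bar>z * s\<bar>" using s by (simp add: abs_mult)
      also have "\<dots> < k/16 + 1/2 * s * \<eta>" using rz h(3) by linarith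
      finally have "\<bar>z\<bar> < k/8 + s * \<eta>" by simp
      moreover have "s * \<eta> \<le> 2 * (k/8)" using s \<eta> by (intro mult_mono) auto
      ultimately have "\<bar>z\<bar> < k/8 + k/4" by linarith
      then have z: "\<bar>z\<bar> < 3/8 * k" by simp
      then have "\<bar>real_of_int j\<bar> * \<eta> \<le> k / 2" using \<eta> k by (simp add: z_def abs_mult)
      then have "\<bar>real_of_int j\<bar> \<le> k / (2 * \<eta>)" using \<eta> by (simp add: field_simps)
      then have "\<bar>j\<bar> \<le> J" unfolding J_def by (simp add: le_floor_iff)
      then have jJ: "j \<in> {-J..J}" by auto
      have "\<bar>z * q\<bar> \<le> 3/8 * k * (p/4)" unfolding abs_mult using z h(4) k by (intro mult_mono) auto
      also have "\<dots> = k * p * (3/32)" by simp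
      finally have zq: "\<bar>z * q\<bar> \<le> k * p * (3/32)" .
      have "k * p \<le> 1/4 * p" "k * p \<le> k * (9/8)"
        using k p by (auto intro!: mult_mono)
      then have zq': "\<bar>z * q\<bar> < k/2" "\<bar>z * q\<bar> \<le> p/4" using zq k p by linarith+
      have "A ** mk 1 0 z 1 = mk (p + q * z) q (r + s * z) s" by (simp add: A')
      moreover have "mk (p + q * z) q (r + s * z) s \<in> entry_box k \<eta> (1/2)"
        unfolding mk_in_entry_box
      proof (intro conjI)
        show "(p + q * z) * s - q * (r + s * z) = 1" using h(1) by (simp add: algebra_simps)
        have "\<bar>(p - 1) + z * q\<bar> < k"
          using abs_triangle_ineq[of "p - 1" "z * q"] h(2) zq'(1) by linarith
        then show "\<bar>p + q * z - 1\<bar> < k" by (simp add: algebra_simps)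
        show "\<bar>r + s * z\<bar> < \<eta>" using rz' by (simp add: mult.commute)
        have "- (p/4) \<le> z * q" using zq'(2) by (simp add: abs_le_iff)
        then show "\<bar>q\<bar> < 1/2 * (p + q * z)" using h(4) p by (simp add: mult.commute[of q])
      qed
      ultimately have "A ** mk 1 0 z 1 \<in> entry_box k \<eta> (1/2)" by (simp only:)
      then show ?thesis using jJ unfolding z_def by blast
    qed
    have "?R \<subseteq> (\<Union>j\<in>{-J..J}. rt (?Q \<eta>) (mk 1 0 (- (j * \<eta>)) 1))"
    proof
      fix X assume "X \<in> ?R"
      then obtain L A where X: "L \<in> D" "A \<in> entry_box (k/2) (k/16) (1/4)" "X = L ** (g ** A)"
        by (auto simp: sat_def)
      obtain j where j: "j \<in> {-J..J}" "A ** mk 1 0 (j * \<eta>) 1 \<in> entry_box k \<eta> (1/2)"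
        using cover[OF X(2)] by blast
      have "L ** (g ** (A ** mk 1 0 (j * \<eta>) 1)) \<in> ?Q \<eta>"
        unfolding sat_def using X j by blast
      moreover have "X = L ** (g ** (A ** mk 1 0 (j * \<eta>) 1)) ** mk 1 0 (- (j * \<eta>)) 1"
      proof -
        have "mk 1 0 (j * \<eta>) 1 ** mk 1 0 (- (j * \<eta>)) 1 = mat 1" by (simp add: mat_1_mk)
        then show ?thesis unfolding X(3)
          by (metis (no_types, lifting) matrix_mul_assoc matrix_mul_rid)
      qed
      ultimately show "X \<in> (\<Union>j\<in>{-J..J}. rt (?Q \<eta>) (mk 1 0 (- (j * \<eta>)) 1))"
        using j(1) by blast
    qed
    then have "measure \<mu> ?R \<le> measure \<mu> (\<Union>j\<in>{-J..J}. rt (?Q \<eta>) (mk 1 0 (- (j * \<eta>)) 1))"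
      using sets rt_sets by (intro finite_measure_mono) auto
    also have "\<dots> \<le> (\<Sum>j\<in>{-J..J}. measure \<mu> (rt (?Q \<eta>) (mk 1 0 (- (j * \<eta>)) 1)))"
      using sets rt_sets by (intro finite_measure_subadditive_finite) auto
    also have "\<dots> = (\<Sum>j\<in>{-J..J}. measure \<mu> (?Q \<eta>))"
      using sets by (intro sum.cong refl measure_rt) auto
    also have "\<dots> = real_of_int (2 * J + 1) * measure \<mu> (?Q \<eta>)"
      using J0 by (simp add: algebra_simps)
    finally have le: "measure \<mu> ?R \<le> real_of_int (2 * J + 1) * measure \<mu> (?Q \<eta>)" .
    have "real_of_int J \<le> k / (2 * \<eta>)" unfolding J_def by (rule of_int_floor_le)
    then have "real_of_int J * (2 * \<eta>) \<le> k" using \<eta> by (simp add: pos_le_divide_eq)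
    then have "real_of_int (2 * J + 1) * \<eta> \<le> 1" using \<eta> k by (simp add: algebra_simps)
    then have "real_of_int (2 * J + 1) * \<eta> * measure \<mu> (?Q \<eta>) \<le> 1 * measure \<mu> (?Q \<eta>)"
      by (intro mult_right_mono) auto
    moreover have "measure \<mu> ?R * \<eta> \<le> real_of_int (2 * J + 1) * measure \<mu> (?Q \<eta>) * \<eta>"
      using le \<eta> by (intro mult_right_mono) auto
    ultimately show ?thesis by (simp add: mult_ac)
  qed
  then show ?thesis using pos by blast
qed

text \<open>
  The box considered here is a long thin tube, of length about \<open>l\<^sup>2\<close> along a horocycle and of
  thickness about \<open>l\<^sup>-\<^sup>2\<close>. It is the image under the geodesic flow of a box of fixed size \<open>k\<close> around
  the point \<open>g ** dg l\<close>. If \<open>D\<close> has no nontrivial small element when seen from that point, then the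
  tube embeds in the quotient and contains about \<open>l\<^sup>2\<close> disjoint translates of a box of length 1,
  each of measure at least a constant times \<open>l\<^sup>-\<^sup>2\<close>. Hence the measure of the tube has a lower bound
  which does not depend on \<open>l\<close>.
\<close>
lemma measure_tube_lower:
  assumes g: "det g = 1" and k: "0 < k" "k \<le> 1/4" and \<epsilon>: "12 * k \<le> \<epsilon>"
  shows "\<exists>c>0. \<forall>l. l\<^sup>2 \<ge> 8 \<longrightarrow> l > 0 \<longrightarrow> k * l\<^sup>2 \<ge> 1 \<longrightarrow>
    (\<forall>L\<in>D. near \<epsilon> (adj (g ** dg l) ** L ** (g ** dg l)) \<longrightarrow> L = mat 1) \<longrightarrow>
    c \<le> measure \<mu> (sat ((\<lambda>A. g ** A) ` entry_box k (k / l\<^sup>2) (k * l\<^sup>2)))"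
proof -
  obtain c where c: "c > 0" "\<And>\<eta>. 0 < \<eta> \<Longrightarrow> \<eta> \<le> k/8 \<Longrightarrow>
      c * \<eta> \<le> measure \<mu> (sat ((\<lambda>A. g ** A) ` entry_box k \<eta> (1/2)))"
    using measure_flow_box_lower[OF g k] by blast
  have op: "openSL (sat ((\<lambda>A. g ** A) ` entry_box a b c))" for a b c
    by (intro openSL_sat left_translate_openSL openSL_entry_box g)
  have inv: "left_inv D (sat ((\<lambda>A. g ** A) ` entry_box a b c))" for a b c
    using g entry_box_subset_SL by (intro left_inv_sat) (fastforce simp: det_mul)
  note sets = open_sets[OF op inv]
  have "c * k\<^sup>2 / 2 \<le> measure \<mu> (sat ((\<lambda>A. g ** A) ` entry_box k (k / l\<^sup>2) (k * l\<^sup>2)))"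
    if l: "l\<^sup>2 \<ge> 8" "l > 0" "k * l\<^sup>2 \<ge> 1"
      and thin: "\<And>L. L \<in> D \<Longrightarrow> near \<epsilon> (adj (g ** dg l) ** L ** (g ** dg l)) \<Longrightarrow> L = mat 1" for l
  proof -
    let ?\<eta> = "k / l\<^sup>2"
    let ?P = "entry_box k (k / l\<^sup>2) (k * l\<^sup>2)"
    let ?Q = "entry_box k ?\<eta> (1/2)"
    define n where "n = nat \<lfloor>k * l\<^sup>2\<rfloor>"
    have n1: "real n \<le> k * l\<^sup>2" "k * l\<^sup>2 < real n + 1"
      using l(3) by (simp_all add: n_def)
    have "1 \<le> \<lfloor>k * l\<^sup>2\<rfloor>" using l(3) by simp
    then have "1 \<le> real n" by (simp add: n_def)
    then have n: "real n \<ge> k * l\<^sup>2 / 2" using n1 by linarith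
    \<comment> \<open>an element of \<open>D\<close> that moves a point of the tube to another one is small when seen from
      \<open>g ** dg l\<close>\<close>
    have inj: "L = mat 1 \<and> A = B"
      if "L \<in> D" "A \<in> ?P" "B \<in> ?P" "L ** (g ** A) = g ** B" for L A B
    proof -
      define u where "u = adj (dg l) ** A ** dg l"
      define v where "v = adj (dg l) ** B ** dg l"
      have uv: "u \<in> entry_box k k k" "v \<in> entry_box k k k"
        unfolding u_def v_def using that l by (intro conj_entry_box; simp)+
      then have "near (3 * k) v" "near (3 * k) (adj u)" using k by (auto intro: entry_box_near)
      then have "near (3 * k + 3 * k + 2 * (3 * k) * (3 * k)) (v ** adj u)" by (rule near_mult)
      moreover have "3 * k + 3 * k + 2 * (3 * k) * (3 * k) \<le> \<epsilon>"
      proof -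
        have "k * k \<le> 1/4 * k" using k by (intro mult_right_mono) auto
        moreover have "3 * k + 3 * k + 2 * (3 * k) * (3 * k) = 6 * k + 18 * (k * k)" by simp
        ultimately show ?thesis using \<epsilon> k by linarith
      qed
      ultimately have nr: "near \<epsilon> (v ** adj u)" by (rule near_mono)
      have dA: "det A = 1" "det B = 1" "det (dg l) = 1" using that l by (auto simp: entry_box_def)
      have "adj (g ** dg l) ** L ** (g ** dg l) = v ** adj u"
      proof -
        have "L ** g = g ** B ** adj A"
          using that(4) dA by (metis matrix_mul_assoc mult_adj(3))
        then have "adj (g ** dg l) ** L ** (g ** dg l) = adj (dg l) ** (adj g ** (g ** (B ** adj A))) ** dg l"
          by (metis (no_types, lifting) adj_mult matrix_mul_assoc)
        also have "\<dots> = adj (dg l) ** B ** adj A ** dg l"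
          using g by (simp add: matrix_mul_assoc)
        also have "\<dots> = adj (dg l) ** B ** (dg l ** (adj (dg l) ** (adj A ** dg l)))"
          using mult_adj(6)[OF dA(3)] by (simp only: matrix_mul_assoc)
        also have "\<dots> = v ** adj u"
          by (simp only: u_def v_def adj_mult adj_adj matrix_mul_assoc)
        finally show ?thesis .
      qed
      then have L: "L = mat 1" using thin[OF that(1)] nr by simp
      then have "g ** A = g ** B" using that(4) by simp
      then have "adj g ** (g ** A) = adj g ** (g ** B)" by simp
      then show ?thesis using g L by simp
    qed
    have QP: "A ** up (real j) \<in> ?P" if A: "A \<in> ?Q" and j: "j < n" for A j
    proof -
      obtain p q r s where A': "A = mk p q r s" by (cases A)
      have h: "p * s - q * r = 1" "\<bar>p - 1\<bar> < k" "\<bar>r\<bar> < ?\<eta>" "\<bar>q\<bar> < p/2"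
        using A by (simp_all add: A' mk_in_entry_box)
      have p: "p > 0" using h(2) k by linarith
      have "real j + 1 \<le> k * l\<^sup>2" using j n1 by linarith
      then have "(real j + 1) * p \<le> k * l\<^sup>2 * p" using p by (intro mult_right_mono) auto
      moreover have "\<bar>p * real j + q\<bar> < (real j + 1) * p"
      proof -
        have "p * real j \<ge> 0" using p by simp
        then have "\<bar>p * real j + q\<bar> < p * real j + p" using h(4) p by linarith
        then show ?thesis by (simp add: algebra_simps)
      qed
      ultimately have "\<bar>p * real j + q\<bar> < k * l\<^sup>2 * p" by linarith
      moreover have "p * (r * real j + s) - (p * real j + q) * r = 1"
        using h(1) by (simp add: algebra_simps)
      ultimately show ?thesis using h by (simp add: A' mk_in_entry_box)
    qed
    define S where "S j = rt (sat ((\<lambda>A. g ** A) ` ?Q)) (up (real j))" for j :: nat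
    have S_eq: "S j = (\<Union>L\<in>D. (\<lambda>A. L ** (g ** (A ** up (real j)))) ` ?Q)" for j
      by (simp add: S_def sat_def image_UN image_image matrix_mul_assoc)
    have S_sets: "S j \<in> sets \<mu>" for j unfolding S_def using sets by (intro rt_sets) auto
    have disj: "disjoint_family_on S {..<n}"
      unfolding disjoint_family_on_def
    proof (intro ballI impI)
      fix i j assume ij: "i \<in> {..<n}" "j \<in> {..<n}" "i \<noteq> j"
      show "S i \<inter> S j = {}"
      proof (rule ccontr)
        assume "S i \<inter> S j \<noteq> {}"
        then obtain L A K B where X: "L \<in> D" "A \<in> ?Q" "K \<in> D" "B \<in> ?Q"
          "L ** (g ** (A ** up (real i))) = K ** (g ** (B ** up (real j)))"
          unfolding S_eq by blast
        have "adj K ** L ** (g ** (A ** up (real i))) = adj K ** (K ** (g ** (B ** up (real j))))"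
          using X(5) by (simp only: matrix_mul_assoc[symmetric])
        also have "\<dots> = g ** (B ** up (real j))" using D_SL[OF X(3)] by simp
        finally have "A ** up (real i) = B ** up (real j)"
          using inj[OF _ QP[OF X(2)] QP[OF X(4)]] X ij
            discrete_subgroup_closed(2,3)[OF discrete] by blast
        moreover obtain p q r s where A': "A = mk p q r s" by (cases A)
        moreover obtain p' q' r' s' where B': "B = mk p' q' r' s'" by (cases B)
        ultimately have "p = p'" "p * real i + q = p' * real j + q'" by auto
        then have e: "p' = p" "p * real i + q = p * real j + q'" by simp_all
        have h: "\<bar>p - 1\<bar> < k" "\<bar>q\<bar> < p/2" "\<bar>q'\<bar> < p/2"
          using X(2,4) by (simp_all add: A' B' mk_in_entry_box e)
        then have p: "p > 0" using k by linarith
        have "p * (real i - real j) = q' - q" using e by (simp add: algebra_simps)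
        then have "p * \<bar>real i - real j\<bar> = \<bar>q' - q\<bar>" using p by (metis abs_mult abs_of_pos)
        also have "\<dots> < p * 1" using h by linarith
        finally have "\<bar>real i - real j\<bar> < 1" using p by simp
        then show False using ij(3) by linarith
      qed
    qed
    have "c * (k / l\<^sup>2) \<le> measure \<mu> (sat ((\<lambda>A. g ** A) ` ?Q))"
    proof (rule c(2))
      show "k / l\<^sup>2 \<le> k / 8" using l k by (intro divide_left_mono) auto
    qed (use k l in auto)
    then have "real n * (c * (k / l\<^sup>2)) \<le> real n * measure \<mu> (sat ((\<lambda>A. g ** A) ` ?Q))"
      by (intro mult_left_mono) auto
    moreover have "(k * l\<^sup>2 / 2) * (c * (k / l\<^sup>2)) \<le> real n * (c * (k / l\<^sup>2))"
      using n c k l by (intro mult_right_mono) auto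
    moreover have "(k * l\<^sup>2 / 2) * (c * (k / l\<^sup>2)) = c * k\<^sup>2 / 2"
      using l by (simp add: power2_eq_square)
    ultimately have "c * k\<^sup>2 / 2 \<le> real n * measure \<mu> (sat ((\<lambda>A. g ** A) ` ?Q))" by linarith
    also have "\<dots> = (\<Sum>j<n. measure \<mu> (S j))"
      unfolding S_def using sets by (subst sum.cong[OF refl measure_rt]) auto
    also have "\<dots> = measure \<mu> (\<Union>j<n. S j)"
      using S_sets disj by (intro finite_measure_finite_Union[symmetric]) auto
    also have "\<dots> \<le> measure \<mu> (sat ((\<lambda>A. g ** A) ` ?P))"
    proof (rule finite_measure_mono)
      show "(\<Union>j<n. S j) \<subseteq> sat ((\<lambda>A. g ** A) ` ?P)"
        unfolding S_eq sat_def using QP by blast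
    qed (use sets in auto)
    finally show ?thesis .
  qed
  moreover have "c * k\<^sup>2 / 2 > 0" using c k by simp
  ultimately show ?thesis by blast
qed

end

section \<open>Horocycles are closed or dense\<close>

context lattice_measure
begin

text \<open>
  Let \<open>W\<close> be a nonempty open invariant set that small elements translate from the right into \<open>V\<close>.
  By ergodicity, the points that reach \<open>W\<close> within some horocycle time \<open>N\<close> have almost full measure,
  so some of them lie in the tube of \<open>measure_tube_lower\<close> around the horocycle of \<open>g\<close>. When \<open>l\<^sup>2\<close>
  exceeds \<open>N\<close>, the tube is so thin that after time \<open>N\<close> its points are still close to that horocycle,
  which therefore meets \<open>V\<close> itself.
\<close>
lemma dense_if_thick:
  assumes g: "det g = 1" and \<epsilon>: "\<epsilon> > 0"
    and thick: "\<And>l0. \<exists>l\<ge>l0. \<forall>L\<in>D. near \<epsilon> (adj (g ** dg l) ** L ** (g ** dg l)) \<longrightarrow> L = mat 1"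
    and V: "openSL V" "left_inv D V" "V \<noteq> {}"
  shows "\<exists>s. g ** up s \<in> V"
proof -
  obtain B where B: "B \<in> V" using V(3) by auto
  have dB: "det B = 1" using B V(2) by (auto simp: left_inv_def)
  obtain \<delta>0 where \<delta>0: "\<delta>0 > 0" "\<And>A. A \<in> SL \<Longrightarrow> near \<delta>0 A \<Longrightarrow> B ** A \<in> V"
    using ex_near[OF V(1) B] by blast
  define \<delta> where "\<delta> = min (1/2) (\<delta>0 / 3)"
  have "\<delta> * \<delta> \<le> 1/2 * \<delta>" using \<delta>0(1) by (intro mult_right_mono) (auto simp: \<delta>_def)
  moreover have "\<delta> \<le> \<delta>0 / 3" by (simp add: \<delta>_def)
  ultimately have \<delta>: "\<delta> > 0" "\<delta> + \<delta> + 2 * \<delta> * \<delta> \<le> \<delta>0"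
    using \<delta>0(1) by (auto simp: \<delta>_def)
  define W where "W = sat ((\<lambda>A. B ** A) ` {A \<in> SL. near \<delta> A})"
  have W: "openSL W" "left_inv D W" "W \<noteq> {}"
  proof -
    show "openSL W" unfolding W_def by (intro openSL_sat left_translate_openSL openSL_near dB)
    show "left_inv D W" unfolding W_def by (rule left_inv_sat) (auto simp: det_mul dB)
    have "B ** mat 1 \<in> (\<lambda>A. B ** A) ` {A \<in> SL. near \<delta> A}" using \<delta>(1) by (intro imageI) simp
    then have "B ** mat 1 \<in> W" unfolding W_def using subset_sat by (rule rev_subsetD)
    then show "W \<noteq> {}" by auto
  qed
  have WV: "A ** h \<in> V" if "A \<in> W" "det h = 1" "near \<delta> h" for A h
  proof -
    obtain L X where X: "L \<in> D" "det X = 1" "near \<delta> X" "A = L ** (B ** X)"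
      using \<open>A \<in> W\<close> by (auto simp: W_def sat_def)
    have "near \<delta>0 (X ** h)" using near_mult[OF X(3) that(3)] \<delta>(2) by (rule near_mono)
    then have "B ** (X ** h) \<in> V" using X that by (intro \<delta>0(2)) (auto simp: det_mul)
    then have "L ** (B ** (X ** h)) \<in> V" using V(2) X(1) by (simp add: left_inv_def)
    then show ?thesis by (simp add: X(4) matrix_mul_assoc)
  qed
  \<comment> \<open>the width of the tube: small against \<open>\<epsilon>\<close> for it to embed, and against \<open>\<delta>\<close> for its points
    to stay close to the horocycle\<close>
  define k where "k = min (1/16) (min (\<epsilon> / 12) (\<delta> / 16))"
  have k: "0 < k" "k \<le> 1/16" "12 * k \<le> \<epsilon>" "16 * k \<le> \<delta>"
    using \<epsilon> \<delta>(1) by (auto simp: k_def)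
  obtain c where c: "c > 0" "\<And>l. l\<^sup>2 \<ge> 8 \<Longrightarrow> l > 0 \<Longrightarrow> k * l\<^sup>2 \<ge> 1 \<Longrightarrow>
      (\<forall>L\<in>D. near \<epsilon> (adj (g ** dg l) ** L ** (g ** dg l)) \<longrightarrow> L = mat 1) \<Longrightarrow>
      c \<le> measure \<mu> (sat ((\<lambda>A. g ** A) ` entry_box k (k / l\<^sup>2) (k * l\<^sup>2)))"
    using measure_tube_lower[OF g _ _ k(3)] k by fastforce
  obtain N where N: "N > 0"
    "measure \<mu> SL - c < measure \<mu> (\<Union>s\<in>{-N<..<N}. rt W (up s))"
    using horocycle_saturation_large[OF W c(1)] by blast
  obtain l where l: "l \<ge> max 3 (max N (1 / k))"
    "\<forall>L\<in>D. near \<epsilon> (adj (g ** dg l) ** L ** (g ** dg l)) \<longrightarrow> L = mat 1"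
    using thick by blast
  have l3: "l \<ge> 3" "l \<ge> N" "l \<ge> 1 / k" using l(1) by auto
  have "l * 1 \<le> l * l" using l3 by (intro mult_left_mono) auto
  then have ll: "l \<le> l\<^sup>2" by (simp add: power2_eq_square)
  have "3 * 3 \<le> l * l" using l3 by (intro mult_mono) auto
  then have l8: "8 \<le> l\<^sup>2" by (simp add: power2_eq_square)
  have kl: "1 \<le> k * l\<^sup>2"
  proof -
    have "1 / k \<le> l\<^sup>2" using ll l3(3) by linarith
    then show ?thesis using k(1) by (simp add: pos_divide_le_eq mult.commute)
  qed
  let ?P = "entry_box k (k / l\<^sup>2) (k * l\<^sup>2)"
  let ?T = "sat ((\<lambda>A. g ** A) ` ?P)"
  let ?U = "\<Union>s\<in>{-N<..<N}. rt W (up s)"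
  have c_le: "c \<le> measure \<mu> ?T" using l8 kl l3 l(2) by (intro c(2)) auto
  have T: "?T \<in> sets \<mu>" "?T \<subseteq> SL"
  proof -
    have "left_inv D ?T" using g entry_box_subset_SL by (intro left_inv_sat) (fastforce simp: det_mul)
    then show "?T \<in> sets \<mu>" "?T \<subseteq> SL"
      by (auto intro!: open_sets openSL_sat left_translate_openSL openSL_entry_box g simp: left_inv_def)
  qed
  have U: "?U \<in> sets \<mu>" "?U \<subseteq> SL"
  proof -
    have "left_inv D ?U" using W by (auto intro!: left_inv_UN left_inv_rt)
    then show "?U \<in> sets \<mu>" "?U \<subseteq> SL"
      using W by (auto intro!: open_sets openSL_rt simp: left_inv_def)
  qed
  have "?T \<inter> ?U \<noteq> {}"
  proof
    assume "?T \<inter> ?U = {}"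
    then have "measure \<mu> ?T + measure \<mu> ?U = measure \<mu> (?T \<union> ?U)"
      using T U by (intro finite_measure_Union[symmetric]) auto
    also have "\<dots> \<le> measure \<mu> SL"
      using T U space by (intro finite_measure_mono) (auto, metis sets.top)
    finally show False using c_le N(2) by linarith
  qed
  then obtain X where X: "X \<in> ?T" "X \<in> ?U" by blast
  obtain L A where LA: "L \<in> D" "A \<in> ?P" "X = L ** (g ** A)"
    using X(1) unfolding sat_def by blast
  obtain v s where vs: "v \<in> W" "s \<in> {-N<..<N}" "X = v ** up s" using X(2) by blast
  have A: "L \<in> D" "A \<in> ?P" "v \<in> W" "\<bar>s\<bar> < N" "L ** (g ** A) = v ** up s"
    using LA vs by auto
  have "adj L ** (L ** (g ** A)) ** up (-s) = adj L ** (v ** up s ** up (-s))"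
    using arg_cong[OF A(5), of "\<lambda>X. adj L ** X ** up (-s)"] by (simp only: matrix_mul_assoc)
  also have "v ** up s ** up (-s) = v"
    using mult_adj(3)[of "up s" v] by simp
  finally have "g ** (A ** up (-s)) = adj L ** v"
    using D_SL[OF A(1)] by (simp add: matrix_mul_assoc)
  moreover have "adj L ** v \<in> W"
    using W(2) A(1,3) discrete_subgroup_closed(3)[OF discrete] by (simp add: left_inv_def)
  ultimately have gW: "g ** (A ** up (-s)) \<in> W" by simp
  obtain p q' r d' where A': "A = mk p q' r d'" by (cases A)
  have h: "p * d' - q' * r = 1" "\<bar>p - 1\<bar> < k" "\<bar>r\<bar> < k / l\<^sup>2" "\<bar>q'\<bar> < k * l\<^sup>2 * p"
    using A(2) by (simp_all add: A' mk_in_entry_box)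
  have p: "15/16 < p" "p < 17/16" using h(2) k by linarith+
  have l2: "l\<^sup>2 > 0" using l8 by linarith
  define q where "q = q' - s * p"
  define d where "d = d' - s * r"
  have As: "A ** up (-s) = mk p q r d"
    by (simp add: A' q_def d_def algebra_simps)
  have dt: "p * d - q * r = 1" using h(1) by (simp add: q_def d_def algebra_simps)
  have "\<bar>q\<bar> \<le> \<bar>q'\<bar> + \<bar>s * p\<bar>" unfolding q_def by (rule abs_triangle_ineq4)
  also have "\<bar>s * p\<bar> = \<bar>s\<bar> * p" using p by (simp add: abs_mult)
  also have "\<bar>s\<bar> * p \<le> l\<^sup>2 * p" using A(4) l3 ll p by (intro mult_right_mono) auto
  also have "\<bar>q'\<bar> \<le> 1/16 * l\<^sup>2 * p"
  proof -
    have "k * l\<^sup>2 * p \<le> 1/16 * l\<^sup>2 * p" using k p by (intro mult_right_mono) auto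
    then show ?thesis using h(4) by linarith
  qed
  finally have q1: "\<bar>q\<bar> \<le> 17/16 * (l\<^sup>2 * p)" by (simp add: mult.commute)
  have "l\<^sup>2 * p \<le> l\<^sup>2 * (17/16)" using p l2 by (intro mult_left_mono) auto
  then have q2: "\<bar>q\<bar> \<le> 2 * l\<^sup>2" using q1 l2 by linarith
  have "\<bar>q * r\<bar> \<le> 2 * l\<^sup>2 * (k / l\<^sup>2)"
    unfolding abs_mult using q2 h(3) l2 by (intro mult_mono) auto
  then have qr: "\<bar>q * r\<bar> \<le> 2 * k" using l2 by simp
  have d1: "\<bar>d - 1\<bar> \<le> 4 * k"
  proof -
    have "p * (d - 1) = q * r - (p - 1)" using dt by (simp add: algebra_simps)
    moreover have "p > 0" using p by linarith
    ultimately have "p * \<bar>d - 1\<bar> = \<bar>q * r - (p - 1)\<bar>" by (metis abs_mult abs_of_pos)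
    also have "\<dots> \<le> 3 * k" using qr h(2) by linarith
    finally have "p * \<bar>d - 1\<bar> \<le> 3 * k" .
    moreover have "15/16 * \<bar>d - 1\<bar> \<le> p * \<bar>d - 1\<bar>" using p by (intro mult_right_mono) auto
    ultimately have "15/16 * \<bar>d - 1\<bar> \<le> 3 * k" by (rule order.trans[rotated])
    then show ?thesis using k(1) by simp
  qed
  have dpos: "d \<ge> 3/4" using d1 k(2) by linarith
  have d2: "\<bar>1 / d - 1\<bar> < \<delta>"
  proof -
    have "1 / d - 1 = (1 - d) / d" using dpos by (simp add: field_simps)
    then have "\<bar>1 / d - 1\<bar> = \<bar>d - 1\<bar> / d" using dpos by (simp add: abs_minus_commute)
    also have "\<dots> \<le> (4 * k) / (3/4)" using d1 dpos by (intro frac_le) auto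
    also have "\<dots> < 16 * k" using k by simp
    finally show ?thesis using k(4) by linarith
  qed
  \<comment> \<open>splitting off the part along the horocycle leaves a matrix close to the identity\<close>
  define H where "H = mk (1 / d) 0 r d"
  have "up (q / d) ** H = mk p q r d"
  proof -
    have "1 / d + q / d * r = p" using dt dpos by (simp add: field_simps)
    then show ?thesis using dpos by (simp add: H_def)
  qed
  then have "g ** up (q / d) = g ** (A ** up (-s)) ** adj H"
    using mult_adj(3)[of H "up (q / d)"] dpos
    by (simp add: As H_def matrix_mul_assoc[symmetric] del: mk_mult)
  moreover have "g ** (A ** up (-s)) ** adj H \<in> V"
  proof (rule WV[OF gW])
    show "det (adj H) = 1" using dpos by (simp add: H_def)
    have "k / l\<^sup>2 \<le> k / 1" using k l8 by (intro divide_left_mono) auto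
    then have "\<bar>r\<bar> < k" using h(3) by simp
    then show "near \<delta> (adj H)" using d1 d2 k \<delta>(1) by (simp add: H_def)
  qed
  ultimately show ?thesis by metis
qed

text \<open>
  Hedlund's theorem for one lattice. Either the injectivity radius stays bounded below for a
  sequence of points going to infinity on the geodesic of \<open>g\<close>, and the horocycle is dense; or it
  tends to 0 along the geodesic, and the geodesic runs into a cusp whose parabolic elements close up
  the horocycle.
\<close>
theorem horocycle_closed_or_dense:
  assumes g: "det g = 1"
  shows "(\<exists>s. s \<noteq> 0 \<and> g ** up s ** adj g \<in> D) \<or>
    (\<forall>V. openSL V \<longrightarrow> left_inv D V \<longrightarrow> V \<noteq> {} \<longrightarrow> (\<exists>s. g ** up s \<in> V))"
proof (cases "\<forall>\<epsilon>>0. \<exists>l0. \<forall>l\<ge>l0. \<exists>L\<in>D. L \<noteq> mat 1 \<and> near \<epsilon> (adj (g ** dg l) ** L ** (g ** dg l))")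
  case False
  then obtain \<epsilon> where "\<epsilon> > 0"
    "\<And>l0. \<exists>l\<ge>l0. \<forall>L\<in>D. near \<epsilon> (adj (g ** dg l) ** L ** (g ** dg l)) \<longrightarrow> L = mat 1"
    by blast
  then show ?thesis using dense_if_thick[OF g] by blast
next
  case True
  let ?D' = "(\<lambda>A. adj g ** A ** g) ` D"
  have "\<exists>s. s \<noteq> 0 \<and> up s \<in> ?D'"
  proof (rule unipotent_if_small_elements[OF discrete_subgroup_conj[OF discrete g]])
    fix \<epsilon> :: real assume "\<epsilon> > 0"
    then obtain l0 where l0: "\<And>l. l \<ge> l0 \<Longrightarrow>
        \<exists>L\<in>D. L \<noteq> mat 1 \<and> near \<epsilon> (adj (g ** dg l) ** L ** (g ** dg l))"
      using True by blast
    have "\<exists>x\<in>?D'. x \<noteq> mat 1 \<and> near \<epsilon> (adj (dg l) ** x ** dg l)" if l: "l \<ge> l0" for l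
    proof -
      obtain L where L: "L \<in> D" "L \<noteq> mat 1" "near \<epsilon> (adj (g ** dg l) ** L ** (g ** dg l))"
        using l0[OF l] by blast
      have "adj g ** L ** g \<noteq> mat 1"
      proof
        assume "adj g ** L ** g = mat 1"
        then have "g ** (adj g ** L ** g) ** adj g = mat 1" using g by simp
        then show False using L(2) g by (simp add: matrix_mul_assoc)
      qed
      moreover have "near \<epsilon> (adj (dg l) ** (adj g ** L ** g) ** dg l)"
        using L(3) by (simp only: adj_mult matrix_mul_assoc)
      ultimately show ?thesis using L(1) by blast
    qed
    then show "\<exists>l0. \<forall>l\<ge>l0. \<exists>x\<in>?D'. x \<noteq> mat 1 \<and> near \<epsilon> (adj (dg l) ** x ** dg l)" by blast
  qed
  then obtain s L where s: "s \<noteq> 0" "L \<in> D" "up s = adj g ** L ** g" by blast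
  have "g ** up s ** adj g = L" unfolding s(3) using g by (simp add: matrix_mul_assoc)
  then show ?thesis using s by blast
qed

end

section \<open>The quotients of PSL(2,R) in terms of matrices\<close>

abbreviation qt :: "psl set \<Rightarrow> real^2^2 \<Rightarrow> psl set" where
  "qt \<Gamma> A \<equiv> \<Gamma> #>\<^bsub>PSL2R\<^esub> psl_class A"

lemma psl_class_carrier: "det A = 1 \<Longrightarrow> psl_class A \<in> carrier PSL2R"
  by (simp add: carrier_PSL2R)

lemma psl_class_mem:
  assumes "X \<in> carrier PSL2R" "A \<in> X"
  shows "det A = 1" "X = psl_class A"
  using assms by (auto simp: carrier_PSL2R psl_class_eq det_minus_2)

text \<open>
  A set \<open>\<Gamma>\<close> of elements of \<open>PSL(2,R)\<close> is a set of pairs of matrices, so \<open>\<Union>\<Gamma>\<close> is its preimage in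
  \<open>SL(2,R)\<close>. All the arguments about matrices apply to this preimage.
\<close>
lemma Union_mem_iff:
  assumes "\<Gamma> \<subseteq> carrier PSL2R"
  shows "A \<in> \<Union>\<Gamma> \<longleftrightarrow> det A = 1 \<and> psl_class A \<in> \<Gamma>"
proof
  assume "A \<in> \<Union>\<Gamma>"
  then obtain X where "X \<in> \<Gamma>" "A \<in> X" by blast
  then show "det A = 1 \<and> psl_class A \<in> \<Gamma>" using psl_class_mem assms by blast
next
  assume "det A = 1 \<and> psl_class A \<in> \<Gamma>"
  moreover have "A \<in> psl_class A" by (simp add: psl_class_eq)
  ultimately show "A \<in> \<Union>\<Gamma>" by blast
qed

lemma one_PSL2R: "\<one>\<^bsub>PSL2R\<^esub> = psl_class (mat 1)"
proof -
  interpret group PSL2R by (rule group_PSL2R)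
  have "psl_class (mat 1) \<otimes>\<^bsub>PSL2R\<^esub> psl_class (mat 1) = psl_class (mat 1)"
    by (subst mult_psl_class) auto
  then show ?thesis using psl_class_carrier[of "mat 1"]
    by (metis det_I l_cancel_one' )
qed

lemma inv_psl_class:
  assumes "det A = 1"
  shows "inv\<^bsub>PSL2R\<^esub> (psl_class A) = psl_class (adj A)"
proof -
  interpret group PSL2R by (rule group_PSL2R)
  show ?thesis
    by (rule inv_equality) (use assms in \<open>auto simp: mult_psl_class one_PSL2R psl_class_carrier\<close>)
qed

lemma subgroup_matrices:
  assumes "subgroup \<Gamma> PSL2R"
  shows "\<Union>\<Gamma> \<subseteq> SL" "mat 1 \<in> \<Union>\<Gamma>" "A \<in> \<Union>\<Gamma> \<Longrightarrow> B \<in> \<Union>\<Gamma> \<Longrightarrow> A ** B \<in> \<Union>\<Gamma>"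
    "A \<in> \<Union>\<Gamma> \<Longrightarrow> adj A \<in> \<Union>\<Gamma>"
proof -
  have sub: "\<Gamma> \<subseteq> carrier PSL2R" using assms by (rule subgroup.subset)
  note iff = Union_mem_iff[OF sub]
  show "\<Union>\<Gamma> \<subseteq> SL" using iff by blast
  show "mat 1 \<in> \<Union>\<Gamma>" using subgroup.one_closed[OF assms] by (simp only: iff one_PSL2R det_I simp_thms)
  show "A ** B \<in> \<Union>\<Gamma>" if "A \<in> \<Union>\<Gamma>" "B \<in> \<Union>\<Gamma>"
    using that subgroup.m_closed[OF assms, of "psl_class A" "psl_class B"]
    by (simp only: iff) (simp add: mult_psl_class det_mul)
  show "adj A \<in> \<Union>\<Gamma>" if "A \<in> \<Union>\<Gamma>"
    using that subgroup.m_inv_closed[OF assms, of "psl_class A"]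
    by (simp only: iff) (simp add: inv_psl_class)
qed

text \<open>
  The points of \<open>T1 \<Gamma>\<close> are thus the orbits of \<open>\<Union>\<Gamma>\<close> on \<open>SL(2,R)\<close>.
\<close>
lemma qt_eq_iff:
  assumes "subgroup \<Gamma> PSL2R" "det A = 1" "det B = 1"
  shows "qt \<Gamma> A = qt \<Gamma> B \<longleftrightarrow> (\<exists>L\<in>\<Union>\<Gamma>. B = L ** A)"
proof
  interpret group PSL2R by (rule group_PSL2R)
  have sub: "\<Gamma> \<subseteq> carrier PSL2R" using assms by (auto dest: subgroup.subset)
  note c = psl_class_carrier
  {
    assume "qt \<Gamma> A = qt \<Gamma> B"
    then have "psl_class B \<in> qt \<Gamma> A"
      using rcos_self[OF c[OF assms(3)] assms(1)] by simp
    then obtain h where h: "h \<in> \<Gamma>" "psl_class B = h \<otimes>\<^bsub>PSL2R\<^esub> psl_class A"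
      by (auto simp: r_coset_def)
    have "h = psl_class B \<otimes>\<^bsub>PSL2R\<^esub> inv\<^bsub>PSL2R\<^esub> (psl_class A)"
      using h sub inv_solve_right[of h "psl_class B" "psl_class A"] c[OF assms(2)] c[OF assms(3)]
      by (simp add: subset_eq)
    then have "psl_class (B ** adj A) \<in> \<Gamma>"
      using h(1) assms by (simp add: inv_psl_class mult_psl_class)
    then have "B ** adj A \<in> \<Union>\<Gamma>"
      unfolding Union_mem_iff[OF sub] using assms by (simp add: det_mul)
    moreover have "B = B ** adj A ** A" using assms by simp
    ultimately show "\<exists>L\<in>\<Union>\<Gamma>. B = L ** A" by blast
  next
    assume "\<exists>L\<in>\<Union>\<Gamma>. B = L ** A"
    then obtain L where L: "L \<in> \<Union>\<Gamma>" "B = L ** A" by blast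
    then have L': "det L = 1" "psl_class L \<in> \<Gamma>" using Union_mem_iff[OF sub] by auto
    have "psl_class B = psl_class L \<otimes>\<^bsub>PSL2R\<^esub> psl_class A"
      using L L' assms by (simp add: mult_psl_class)
    then have "psl_class B \<in> qt \<Gamma> A" using L' by (auto simp: r_coset_def)
    then show "qt \<Gamma> A = qt \<Gamma> B"
      using repr_independence[OF _ c[OF assms(2)] assms(1)] by blast
  }
qed

lemma topspace_T1_qt: "topspace (T1 \<Gamma>) = qt \<Gamma> ` SL"
  unfolding topspace_T1 RCOSETS_def carrier_PSL2R by blast

lemma openin_T1_iff:
  "openin (T1 \<Gamma>) U \<longleftrightarrow> U \<subseteq> topspace (T1 \<Gamma>) \<and> openSL {A \<in> SL. qt \<Gamma> A \<in> U}"
proof -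
  have "openin (T1 \<Gamma>) U \<longleftrightarrow> U \<subseteq> topspace (T1 \<Gamma>) \<and>
      openin psl_topology {u \<in> carrier PSL2R. \<Gamma> #>\<^bsub>PSL2R\<^esub> u \<in> U}"
    unfolding T1_def openin_quotient_topology
    using quotient_map_quotient_topology[of psl_topology "\<lambda>u. \<Gamma> #>\<^bsub>PSL2R\<^esub> u"]
    by (simp add: topspace_psl_topology quotient_map_def)
  also have "openin psl_topology {u \<in> carrier PSL2R. \<Gamma> #>\<^bsub>PSL2R\<^esub> u \<in> U} \<longleftrightarrow>
      openSL {A \<in> SL. qt \<Gamma> A \<in> U}"
  proof -
    have "{A \<in> SL. psl_class A \<in> {u \<in> carrier PSL2R. \<Gamma> #>\<^bsub>PSL2R\<^esub> u \<in> U}} = {A \<in> SL. qt \<Gamma> A \<in> U}"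
      using psl_class_carrier by blast
    moreover have "{u \<in> carrier PSL2R. \<Gamma> #>\<^bsub>PSL2R\<^esub> u \<in> U} \<subseteq> psl_class ` SL"
      by (auto simp: carrier_PSL2R)
    ultimately show ?thesis
      unfolding psl_topology_def openin_quotient_topology by simp
  qed
  finally show ?thesis .
qed

lemma qt_mult:
  assumes "subgroup \<Gamma> PSL2R" "det A = 1" "det h = 1"
  shows "qt \<Gamma> A #>\<^bsub>PSL2R\<^esub> psl_class h = qt \<Gamma> (A ** h)"
proof -
  interpret group PSL2R by (rule group_PSL2R)
  show ?thesis
    using assms psl_class_carrier subgroup.subset[OF assms(1)]
    by (simp add: coset_mult_assoc mult_psl_class)
qed

lemma discrete_subgroup_matrices:
  assumes "subgroup \<Gamma> PSL2R" "subtopology psl_topology \<Gamma> = discrete_topology \<Gamma>"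
  shows "discrete_subgroup (\<Union>\<Gamma>)"
proof -
  have one: "psl_class (mat 1) \<in> \<Gamma>"
    using subgroup.one_closed[OF assms(1)] by (simp add: one_PSL2R)
  then have "openin (subtopology psl_topology \<Gamma>) {psl_class (mat 1)}"
    by (simp add: assms(2))
  then obtain W where W: "openin psl_topology W" "{psl_class (mat 1)} = W \<inter> \<Gamma>"
    by (auto simp: openin_subtopology)
  have "openSL {A \<in> SL. psl_class A \<in> W}"
    using W(1) by (simp add: psl_topology_def openin_quotient_topology)
  moreover have "mat 1 \<in> {A \<in> SL. psl_class A \<in> W}" using W(2) by auto
  ultimately obtain \<delta> where \<delta>: "\<delta> > 0"
    "\<And>A. A \<in> SL \<Longrightarrow> near \<delta> A \<Longrightarrow> mat 1 ** A \<in> {A \<in> SL. psl_class A \<in> W}"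
    using ex_near by blast
  have "A = mat 1" if A: "A \<in> \<Union>\<Gamma>" "near (min \<delta> 1) A" for A
  proof -
    have A': "det A = 1" "psl_class A \<in> \<Gamma>"
      using A(1) Union_mem_iff[OF subgroup.subset[OF assms(1)]] by auto
    have "near \<delta> A" "near 1 A" using A(2) by (auto elim: near_mono)
    then have "psl_class A \<in> W" using \<delta>(2)[of A] A' by simp
    then have "psl_class A = psl_class (mat 1)" using A'(2) W(2) by blast
    then have "A = mat 1 \<or> A = - mat 1" by (auto simp: psl_class_eq)
    moreover have "\<not> near 1 (- mat 1)" by (simp add: mat_1_mk)
    ultimately show ?thesis using \<open>near 1 A\<close> by auto
  qed
  then have "\<exists>\<epsilon>>0. \<forall>A\<in>\<Union>\<Gamma>. near \<epsilon> A \<longrightarrow> A = mat 1"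
    using \<delta>(1) by (intro exI[of _ "min \<delta> 1"]) auto
  then show ?thesis
    unfolding discrete_subgroup_def
    using subgroup_matrices[OF assms(1)] by blast
qed

section \<open>Invariant measures on finite covers\<close>

lemma finite_matrix_cosets:
  assumes G: "subgroup G PSL2R" and H: "subgroup H PSL2R"
    and fin: "finite (rcosets\<^bsub>PSL2R\<lparr>carrier := G\<rparr>\<^esub> H)"
  shows "finite ((\<lambda>L. rt (\<Union>H) L) ` \<Union>G)"
proof (rule finite_surj[OF fin])
  note Hiff = Union_mem_iff[OF subgroup.subset[OF H]]
  note Giff = Union_mem_iff[OF subgroup.subset[OF G]]
  show "(\<lambda>L. rt (\<Union>H) L) ` \<Union>G \<subseteq> Union ` (rcosets\<^bsub>PSL2R\<lparr>carrier := G\<rparr>\<^esub> H)"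
  proof
    fix C assume "C \<in> (\<lambda>L. rt (\<Union>H) L) ` \<Union>G"
    then obtain L where L: "L \<in> \<Union>G" "C = rt (\<Union>H) L" by blast
    have L': "det L = 1" "psl_class L \<in> G" using L(1) Giff by auto
    have "C = \<Union>(qt H L)"
    proof (intro equalityI subsetI)
      fix X assume "X \<in> C"
      then obtain K where K: "K \<in> \<Union>H" "X = K ** L" using L(2) by blast
      have K': "det K = 1" "psl_class K \<in> H" using K(1) Hiff by auto
      then have "psl_class X \<in> qt H L"
        using K(2) L' by (auto simp: r_coset_def mult_psl_class[symmetric])
      moreover have "X \<in> psl_class X" by (simp add: psl_class_eq)
      ultimately show "X \<in> \<Union>(qt H L)" by blast
    next
      fix X assume "X \<in> \<Union>(qt H L)"
      then obtain h where h: "h \<in> H" "X \<in> h \<otimes>\<^bsub>PSL2R\<^esub> psl_class L" by (auto simp: r_coset_def)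
      obtain K where K: "det K = 1" "h = psl_class K"
        using h(1) subgroup.subset[OF H] by (auto simp: carrier_PSL2R)
      have "X \<in> psl_class (K ** L)" using h(2) K L' by (simp add: mult_psl_class)
      then have "X = K ** L \<or> X = (- K) ** L" by (auto simp: psl_class_eq matrix_minus_left)
      moreover have "K \<in> \<Union>H" "- K \<in> \<Union>H"
        using h(1) K(2) by (auto simp: psl_class_eq)
      ultimately show "X \<in> C" unfolding L(2) by blast
    qed
    moreover have "qt H L \<in> rcosets\<^bsub>PSL2R\<lparr>carrier := G\<rparr>\<^esub> H"
      using L'(2) unfolding RCOSETS_def r_coset_def by auto
    ultimately show "C \<in> Union ` (rcosets\<^bsub>PSL2R\<lparr>carrier := G\<rparr>\<^esub> H)" by blast
  qed
qed

text \<open>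
  Let \<open>H\<close> be a subgroup of finite index in \<open>G\<close>. An invariant measure on \<open>G\<setminus>PSL(2,R)\<close> lifts to the
  finite cover \<open>H\<setminus>PSL(2,R)\<close>: the measure of a set is the integral of the number of its points in a
  fibre. The points of the fibre over the orbit of \<open>A\<close> correspond to the cosets \<open>C\<close> of \<open>H\<close> in \<open>G\<close>, by
  \<open>C \<mapsto> C A\<close>.
\<close>
locale finite_index_in_lattice =
  fixes G H :: "psl set" and M :: "psl set measure"
  assumes G: "subgroup G PSL2R" and H: "subgroup H PSL2R" and HG: "H \<subseteq> G"
    and fin_cosets: "finite ((\<lambda>L. rt (\<Union>H) L) ` \<Union>G)"
    and spaceM: "space M = topspace (T1 G)"
    and setsM: "sets M = sigma_sets (topspace (T1 G)) {U. openin (T1 G) U}"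
    and finM: "finite_measure M" and nzM: "emeasure M (space M) \<noteq> 0"
    and invM: "\<And>h A. det h = 1 \<Longrightarrow> A \<in> sets M \<Longrightarrow>
      emeasure M ((\<lambda>x. x #>\<^bsub>PSL2R\<^esub> psl_class h) ` A) = emeasure M A"
begin

definition cosets :: "(real^2^2) set set" where
  "cosets = (\<lambda>L. rt (\<Union>H) L) ` \<Union>G"

definition rep :: "(real^2^2) set \<Rightarrow> real^2^2" where
  "rep C = (SOME A. A \<in> C)"

definition lift :: "psl set \<Rightarrow> real^2^2" where
  "lift x = (SOME A. det A = 1 \<and> qt G A = x)"

text \<open>
  With chosen representatives the count is a finite sum of point masses, hence countably additive in
  \<open>B\<close> for each fixed \<open>x\<close>. On left invariant sets it does not depend on the choices.
\<close>
definition fibre_count :: "(real^2^2) set \<Rightarrow> psl set \<Rightarrow> ennreal" where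
  "fibre_count B x = (\<Sum>C\<in>cosets. indicator B (rep C ** lift x))"

definition invsets :: "(real^2^2) set set" where
  "invsets = sigma_sets SL {U. openSL U \<and> left_inv (\<Union>H) U}"

definition cover_measure :: "(real^2^2) measure" where
  "cover_measure = measure_of SL {U. openSL U \<and> left_inv (\<Union>H) U} (\<lambda>B. \<integral>\<^sup>+x. fibre_count B x \<partial>M)"

lemma finite_cosets: "finite cosets"
  using fin_cosets by (simp add: cosets_def)

lemma coset_rep:
  assumes "C \<in> cosets"
  shows "rep C \<in> C" "det (rep C) = 1" "C = rt (\<Union>H) (rep C)" "rep C \<in> \<Union>G"
proof -
  obtain L where L: "L \<in> \<Union>G" "C = rt (\<Union>H) L" using assms unfolding cosets_def by blast
  have "mat 1 ** L \<in> C" unfolding L(2) using subgroup_matrices(2)[OF H] by blast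
  then show r: "rep C \<in> C" unfolding rep_def by (rule someI)
  then obtain K where K: "K \<in> \<Union>H" "rep C = K ** L" using L(2) by blast
  have KG: "K \<in> \<Union>G" using K(1) HG by blast
  show rG: "rep C \<in> \<Union>G" unfolding K(2) using KG L(1) by (rule subgroup_matrices(3)[OF G])
  then show "det (rep C) = 1" using subgroup_matrices(1)[OF G] by blast
  have dK: "det K = 1" using K(1) subgroup_matrices(1)[OF H] by blast
  have "rt (\<Union>H) K = \<Union>H"
  proof (intro equalityI subsetI)
    fix X assume "X \<in> rt (\<Union>H) K"
    then show "X \<in> \<Union>H" using K(1) subgroup_matrices(3)[OF H] by blast
  next
    fix X assume "X \<in> \<Union>H"
    then have "X ** adj K \<in> \<Union>H" using K(1) subgroup_matrices(3,4)[OF H] by blast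
    moreover have "X = X ** adj K ** K" using dK by simp
    ultimately show "X \<in> rt (\<Union>H) K" by blast
  qed
  then have "C = rt (\<Union>H) (K ** L)" unfolding L(2) using rt_rt[of L K "\<Union>H"] by simp
  then show "C = rt (\<Union>H) (rep C)" unfolding K(2) .
qed

lemma rep_iff:
  assumes C: "C \<in> cosets" and B: "left_inv (\<Union>H) B" and A: "det A = 1"
  shows "rep C ** A \<in> B \<longleftrightarrow> (\<forall>X\<in>C. X ** A \<in> B)"
proof
  assume *: "rep C ** A \<in> B"
  show "\<forall>X\<in>C. X ** A \<in> B"
  proof
    fix X assume "X \<in> C"
    then obtain K where K: "K \<in> \<Union>H" "X = K ** rep C" using coset_rep(3)[OF C] by blast
    have "K ** (rep C ** A) \<in> B" using B K(1) * unfolding left_inv_def by blast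
    then show "X ** A \<in> B" by (simp add: K(2) matrix_mul_assoc)
  qed
qed (use coset_rep(1)[OF C] in blast)

lemma lift: "x \<in> topspace (T1 G) \<Longrightarrow> det (lift x) = 1 \<and> qt G (lift x) = x"
  unfolding lift_def topspace_T1_qt by (rule someI_ex) blast

lemma qt_in_topspace: "det A = 1 \<Longrightarrow> qt G A \<in> topspace (T1 G)"
  unfolding topspace_T1_qt by blast

text \<open>
  Changing the lift of a point by an element \<open>L\<close> of \<open>G\<close> permutes the cosets by right
  multiplication with \<open>L\<close>.
\<close>
lemma fibre_count_qt:
  assumes B: "left_inv (\<Union>H) B" and A: "det A = 1"
  shows "fibre_count B (qt G A) = (\<Sum>C\<in>cosets. indicator B (rep C ** A))"
proof -
  have l: "det (lift (qt G A)) = 1" "qt G (lift (qt G A)) = qt G A"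
    using lift[OF qt_in_topspace[OF A]] by auto
  then obtain L where L: "L \<in> \<Union>G" "A = L ** lift (qt G A)"
    using qt_eq_iff[OF G l(1) A] by auto
  have dL: "det L = 1" using L(1) subgroup_matrices(1)[OF G] by blast
  have shift: "rt C K \<in> cosets" if "C \<in> cosets" "K \<in> \<Union>G" for C K
  proof -
    obtain J where J: "J \<in> \<Union>G" "C = rt (\<Union>H) J" using \<open>C \<in> cosets\<close> unfolding cosets_def by blast
    have "J ** K \<in> \<Union>G" using J(1) that(2) by (rule subgroup_matrices(3)[OF G])
    moreover have "rt C K = rt (\<Union>H) (J ** K)" by (simp only: J(2) rt_rt)
    ultimately show ?thesis unfolding cosets_def by blast
  qed
  have "bij_betw (\<lambda>C. rt C L) cosets cosets"
  proof (rule bij_betw_byWitness[where f' = "\<lambda>C. rt C (adj L)"])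
    show "(\<lambda>C. rt C L) ` cosets \<subseteq> cosets" using shift L(1) by blast
    show "(\<lambda>C. rt C (adj L)) ` cosets \<subseteq> cosets"
      using shift subgroup_matrices(4)[OF G L(1)] by blast
  qed (use dL in \<open>simp_all only: rt_rt mult_adj\<close>, simp_all)
  then have "(\<Sum>C\<in>cosets. indicator B (rep C ** lift (qt G A)) :: ennreal) =
      (\<Sum>C\<in>cosets. indicator B (rep (rt C L) ** lift (qt G A)))"
    by (rule sum.reindex_bij_betw[symmetric])
  also have "\<dots> = (\<Sum>C\<in>cosets. indicator B (rep C ** A))"
  proof (rule sum.cong[OF refl])
    fix C assume C: "C \<in> cosets"
    have "rep (rt C L) ** lift (qt G A) \<in> B \<longleftrightarrow> (\<forall>X\<in>rt C L. X ** lift (qt G A) \<in> B)"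
      using rep_iff[OF shift[OF C L(1)] B l(1)] .
    also have "\<dots> \<longleftrightarrow> (\<forall>X\<in>C. X ** (L ** lift (qt G A)) \<in> B)"
      by (simp add: matrix_mul_assoc)
    also have "\<dots> \<longleftrightarrow> rep C ** A \<in> B" using rep_iff[OF C B A] L(2) by simp
    finally show "indicator B (rep (rt C L) ** lift (qt G A)) = (indicator B (rep C ** A) :: ennreal)"
      by (simp add: indicator_def)
  qed
  finally show ?thesis by (simp add: fibre_count_def)
qed

text \<open>
  For an open set the count is lower semicontinuous, since finitely many points of a fibre that lie
  in the set stay in it when the fibre moves a little.
\<close>
lemma fibre_count_open_measurable:
  assumes U: "openSL U" "left_inv (\<Union>H) U"
  shows "fibre_count U \<in> borel_measurable M"
proof (rule borel_measurableI_greater)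
  fix y :: ennreal
  let ?V = "{x \<in> space M. y < fibre_count U x}"
  have "openSL {A \<in> SL. qt G A \<in> ?V}"
  proof (subst openin_subopen, intro ballI)
    fix A assume "A \<in> {A \<in> SL. qt G A \<in> ?V}"
    then have A: "det A = 1" "y < fibre_count U (qt G A)" by auto
    define J where "J = {C \<in> cosets. rep C ** A \<in> U}"
    define T where "T = \<Inter> (insert SL ((\<lambda>C. {X \<in> SL. rep C ** X \<in> U}) ` J))"
    have T: "X \<in> T \<longleftrightarrow> det X = 1 \<and> (\<forall>C\<in>J. rep C ** X \<in> U)" for X
      unfolding T_def by auto
    have "openSL T" unfolding T_def
    proof (rule openin_Inter)
      show "finite (insert SL ((\<lambda>C. {X \<in> SL. rep C ** X \<in> U}) ` J))"
        using finite_cosets by (simp add: J_def)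
      fix S assume "S \<in> insert SL ((\<lambda>C. {X \<in> SL. rep C ** X \<in> U}) ` J)"
      then consider "S = SL" | C where "C \<in> J" "S = {X \<in> SL. rep C ** X \<in> U}" by blast
      then show "openSL S"
      proof cases
        case 2
        then show ?thesis using openSL_left_translate[OF U(1)] coset_rep(2) by (simp add: J_def)
      qed simp
    qed simp
    moreover have "A \<in> T" unfolding T using A(1) by (simp add: J_def)
    moreover have "T \<subseteq> {A \<in> SL. qt G A \<in> ?V}"
    proof
      fix X assume "X \<in> T"
      then have X: "det X = 1" "\<And>C. C \<in> J \<Longrightarrow> rep C ** X \<in> U" using T by auto
      have "fibre_count U (qt G A) \<le> fibre_count U (qt G X)"
        unfolding fibre_count_qt[OF U(2) A(1)] fibre_count_qt[OF U(2) X(1)]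
        using X(2) by (intro sum_mono) (auto simp: indicator_def J_def)
      then have "y < fibre_count U (qt G X)" using A(2) by (rule order.strict_trans2[rotated])
      then show "X \<in> {A \<in> SL. qt G A \<in> ?V}"
        using X(1) qt_in_topspace by (simp add: spaceM)
    qed
    ultimately show "\<exists>T. openSL T \<and> A \<in> T \<and> T \<subseteq> {A \<in> SL. qt G A \<in> ?V}" by blast
  qed
  then have "openin (T1 G) ?V" unfolding openin_T1_iff using spaceM by auto
  then show "?V \<in> sets M" unfolding setsM by blast
qed

lemma generators_Pow: "{U. openSL U \<and> left_inv (\<Union>H) U} \<subseteq> Pow SL"
  by (auto simp: left_inv_def)

lemma sigma_algebra_invsets: "sigma_algebra SL invsets"
  unfolding invsets_def by (rule sigma_algebra_sigma_sets[OF generators_Pow])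

lemma fibre_count_compl:
  assumes "x \<in> space M"
  shows "fibre_count (SL - B) x + fibre_count (B \<inter> SL) x = of_nat (card cosets)"
proof -
  have l: "det (lift x) = 1" using lift assms by (simp add: spaceM)
  have "fibre_count (SL - B) x + fibre_count (B \<inter> SL) x = (\<Sum>C\<in>cosets. 1)"
    unfolding fibre_count_def sum.distrib[symmetric]
    using l coset_rep(2) by (intro sum.cong) (auto simp: indicator_def det_mul)
  then show ?thesis by simp
qed

lemma fibre_count_UN:
  assumes "disjoint_family B"
  shows "fibre_count (\<Union>i. B i) x = (\<Sum>i. fibre_count (B i) x)"
  unfolding fibre_count_def
  by (subst suminf_sum) (auto simp: suminf_indicator[OF assms])

text \<open>
  The sets with a measurable count form a Dynkin system, and the invariant open sets are closed under
  intersection.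
\<close>
lemma invsets_props:
  assumes "B \<in> invsets"
  shows "left_inv (\<Union>H) B \<and> fibre_count B \<in> borel_measurable M"
proof -
  have "Int_stable {U. openSL U \<and> left_inv (\<Union>H) U}"
    by (auto simp: Int_stable_def left_inv_def)
  then show ?thesis
    using generators_Pow assms[unfolded invsets_def]
  proof (induction rule: sigma_sets_induct_disjoint)
    case (basic A)
    then show ?case using fibre_count_open_measurable by simp
  next
    case empty
    show ?case by (simp add: left_inv_def fibre_count_def)
  next
    case (compl A)
    have "A \<inter> SL = A" using compl.IH by (auto simp: left_inv_def)
    have "fibre_count (SL - A) x = of_nat (card cosets) - fibre_count A x" if "x \<in> space M" for x
    proof -
      have "fibre_count A x \<le> (\<Sum>C\<in>cosets. 1)"
        unfolding fibre_count_def by (intro sum_mono) (auto simp: indicator_def)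
      also have "\<dots> < \<infinity>" by (simp add: of_nat_less_top)
      finally have "fibre_count A x \<noteq> \<infinity>" by simp
      then show ?thesis
        using fibre_count_compl[OF that, of A] \<open>A \<inter> SL = A\<close>
        by (metis ennreal_add_diff_cancel_right infinity_ennreal_def)
    qed
    then have "(fibre_count (SL - A) \<in> borel_measurable M) =
        ((\<lambda>x. of_nat (card cosets) - fibre_count A x) \<in> borel_measurable M)"
      by (rule measurable_cong)
    also have "\<dots>" using compl.IH by (intro borel_measurable_minus_ennreal) auto
    finally have "fibre_count (SL - A) \<in> borel_measurable M" .
    moreover have "left_inv (\<Union>H) (SL - A)"
      using compl.IH subgroup_matrices(1,4)[OF H] by (intro left_inv_compl) blast+
    ultimately show ?case by simp
  next
    case (union A)
    have "fibre_count (\<Union>i. A i) = (\<lambda>x. \<Sum>i. fibre_count (A i) x)"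
      using fibre_count_UN[OF union(1)] by blast
    moreover have "left_inv (\<Union>H) (\<Union>i. A i)" using union.IH by (intro left_inv_UN) auto
    moreover have "(\<lambda>x. \<Sum>i. fibre_count (A i) x) \<in> borel_measurable M"
      using union.IH by (intro borel_measurable_suminf_order) auto
    ultimately show ?case by simp
  qed
qed

lemma sets_cover_measure: "sets cover_measure = invsets"
  unfolding cover_measure_def invsets_def using generators_Pow by (rule sets_measure_of)

lemma space_cover_measure: "space cover_measure = SL"
  unfolding cover_measure_def using generators_Pow by (rule space_measure_of)

lemma emeasure_cover_measure:
  assumes "B \<in> invsets"
  shows "emeasure cover_measure B = (\<integral>\<^sup>+x. fibre_count B x \<partial>M)"
proof (rule emeasure_measure_of[OF cover_measure_def generators_Pow])
  show "positive (sets cover_measure) (\<lambda>B. \<integral>\<^sup>+x. fibre_count B x \<partial>M)"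
    by (simp add: positive_def fibre_count_def)
  show "countably_additive (sets cover_measure) (\<lambda>B. \<integral>\<^sup>+x. fibre_count B x \<partial>M)"
    unfolding countably_additive_def sets_cover_measure
  proof (intro allI impI)
    fix A :: "nat \<Rightarrow> (real^2^2) set"
    assume A: "range A \<subseteq> invsets" "disjoint_family A"
    have "(\<Sum>i. \<integral>\<^sup>+x. fibre_count (A i) x \<partial>M) = (\<integral>\<^sup>+x. (\<Sum>i. fibre_count (A i) x) \<partial>M)"
      using A(1) invsets_props by (intro nn_integral_suminf[symmetric]) blast
    then show "(\<Sum>i. \<integral>\<^sup>+x. fibre_count (A i) x \<partial>M) = (\<integral>\<^sup>+x. fibre_count (\<Union>i. A i) x \<partial>M)"
      by (simp add: fibre_count_UN[OF A(2)])
  qed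
  show "B \<in> sets cover_measure" using assms by (simp add: sets_cover_measure)
qed

lemma rt_invsets:
  assumes "B \<in> invsets" "det h = 1"
  shows "rt B h \<in> invsets"
  using assms(1) unfolding invsets_def
proof (induction rule: sigma_sets.induct)
  case (Basic U)
  then show ?case using assms(2) openSL_rt left_inv_rt by blast
next
  case (Compl B)
  have "rt SL h = SL" using right_image_eq[of SL h] assms(2) by (auto simp: det_mul)
  then have "rt (SL - B) h = SL - rt B h" by (simp only: rt_Diff[OF assms(2)])
  then show ?case using sigma_sets.Compl[OF Compl.IH] by simp
next
  case (Union B)
  then show ?case unfolding image_UN by (intro sigma_sets.Union)
qed (auto intro: sigma_sets.Empty)

abbreviation act :: "real^2^2 \<Rightarrow> psl set \<Rightarrow> psl set" where
  "act h x \<equiv> x #>\<^bsub>PSL2R\<^esub> psl_class h"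

lemma act_qt: "det A = 1 \<Longrightarrow> det h = 1 \<Longrightarrow> act h (qt G A) = qt G (A ** h)"
  using qt_mult[OF G] .

lemma act_space:
  assumes "det h = 1" "x \<in> space M"
  shows "act h x \<in> space M" "act (adj h) (act h x) = x"
proof -
  obtain A where A: "det A = 1" "x = qt G A" using assms(2) by (auto simp: spaceM topspace_T1_qt)
  show "act h x \<in> space M" using A assms(1) by (simp add: act_qt spaceM qt_in_topspace det_mul)
  show "act (adj h) (act h x) = x" using A assms(1) by (simp add: act_qt det_mul)
qed

lemma act_measurable:
  assumes h: "det h = 1"
  shows "act h \<in> measurable M M"
proof (rule measurable_sigma_sets[OF setsM])
  show "{U. openin (T1 G) U} \<subseteq> Pow (topspace (T1 G))" using openin_subset by blast
  show "act h \<in> space M \<rightarrow> topspace (T1 G)" using act_space(1)[OF h] by (simp add: spaceM)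
  fix U assume "U \<in> {U. openin (T1 G) U}"
  then have "openSL {A \<in> SL. qt G A \<in> U}" by (simp add: openin_T1_iff)
  then have "openSL {A \<in> SL. A ** h \<in> {A \<in> SL. qt G A \<in> U}}"
    using h by (rule openSL_right_translate)
  moreover have "{A \<in> SL. A ** h \<in> {A \<in> SL. qt G A \<in> U}} =
      {A \<in> SL. qt G A \<in> act h -` U \<inter> space M}"
    using h by (auto simp: act_qt det_mul spaceM qt_in_topspace)
  ultimately have "openin (T1 G) (act h -` U \<inter> space M)"
    unfolding openin_T1_iff by (simp add: spaceM)
  then show "act h -` U \<inter> space M \<in> sets M" unfolding setsM by blast
qed

lemma distr_act:
  assumes h: "det h = 1"
  shows "distr M M (act h) = M"
proof (rule measure_eqI)
  fix B assume "B \<in> sets (distr M M (act h))"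
  then have B: "B \<in> sets M" by simp
  have Bs: "B \<subseteq> space M" using B by (rule sets.sets_into_space)
  have dh: "det (adj h) = 1" using h by simp
  have "act h -` B \<inter> space M = act (adj h) ` B"
  proof (intro equalityI subsetI)
    fix x assume "x \<in> act h -` B \<inter> space M"
    then show "x \<in> act (adj h) ` B" using act_space(2)[OF h] by (intro image_eqI[of _ _ "act h x"]) auto
  next
    fix x assume "x \<in> act (adj h) ` B"
    then obtain z where z: "z \<in> B" "x = act (adj h) z" by blast
    then show "x \<in> act h -` B \<inter> space M"
      using act_space[OF dh, of z] Bs by auto
  qed
  then show "emeasure (distr M M (act h)) B = emeasure M B"
    using invM[OF dh B] by (simp add: emeasure_distr act_measurable[OF h] B)
qed simp

lemma lattice_measure_cover:
  assumes "discrete_subgroup (\<Union>H)"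
  shows "lattice_measure cover_measure (\<Union>H)"
proof -
  interpret M: finite_measure M by (rule finM)
  interpret I: sigma_algebra SL invsets by (rule sigma_algebra_invsets)
  have open_sets: "U \<in> invsets" if "openSL U" "left_inv (\<Union>H) U" for U
    unfolding invsets_def using that by blast
  have "fibre_count SL x = of_nat (card cosets)" if "x \<in> space M" for x
    using fibre_count_compl[OF that, of "{}"] by (simp add: fibre_count_def)
  then have total: "emeasure cover_measure SL = of_nat (card cosets) * emeasure M (space M)"
    unfolding emeasure_cover_measure[OF I.top]
    by (subst nn_integral_cong[of M _ "\<lambda>x. of_nat (card cosets)"]) auto
  have "cosets \<noteq> {}" using subgroup_matrices(2)[OF G] by (auto simp: cosets_def)
  then have "card cosets \<noteq> 0" using finite_cosets by simp
  then have nz: "emeasure cover_measure SL \<noteq> 0" unfolding total using nzM by simp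
  have "emeasure cover_measure SL \<noteq> \<infinity>"
    unfolding total using M.emeasure_finite by (simp add: ennreal_mult_eq_top_iff)
  then have fin: "finite_measure cover_measure"
    by (intro finite_measureI) (simp add: space_cover_measure)
  have inv: "emeasure cover_measure (rt B h) = emeasure cover_measure B"
    if B: "B \<in> invsets" and h: "det h = 1" for B h
  proof -
    have dh: "det (adj h) = 1" using h by simp
    note Bp = invsets_props[OF B]
    have BSL: "B \<subseteq> SL" using Bp by (simp add: left_inv_def)
    have "fibre_count (rt B h) x = fibre_count B (act (adj h) x)" if "x \<in> space M" for x
    proof -
      obtain A where A: "det A = 1" "x = qt G A" using \<open>x \<in> space M\<close> by (auto simp: spaceM topspace_T1_qt)
      have "fibre_count (rt B h) x = (\<Sum>C\<in>cosets. indicator (rt B h) (rep C ** A))"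
        unfolding A(2) using left_inv_rt[OF conjunct1[OF Bp] h] A(1) by (rule fibre_count_qt)
      also have "\<dots> = (\<Sum>C\<in>cosets. indicator B (rep C ** (A ** adj h)))"
        using mem_rt[OF BSL h] coset_rep(2) A(1)
        by (intro sum.cong) (auto simp: indicator_def det_mul matrix_mul_assoc)
      also have "\<dots> = fibre_count B (qt G (A ** adj h))"
        using Bp A(1) h by (intro fibre_count_qt[symmetric]) (auto simp: det_mul)
      finally show ?thesis using A dh by (simp add: act_qt)
    qed
    then have "emeasure cover_measure (rt B h) = (\<integral>\<^sup>+x. fibre_count B (act (adj h) x) \<partial>M)"
      unfolding emeasure_cover_measure[OF rt_invsets[OF B h]] by (rule nn_integral_cong)
    also have "\<dots> = (\<integral>\<^sup>+x. fibre_count B x \<partial>distr M M (act (adj h)))"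
      using Bp act_measurable[OF dh] by (intro nn_integral_distr[symmetric]) auto
    also have "\<dots> = emeasure cover_measure B"
      unfolding distr_act[OF dh] emeasure_cover_measure[OF B] ..
    finally show ?thesis .
  qed
  show ?thesis
    unfolding lattice_measure_def lattice_measure_axioms_def
    using fin assms nz inv rt_invsets open_sets
    by (auto simp: space_cover_measure sets_cover_measure)
qed

end

section \<open>Towers of coverings\<close>

text \<open>
  Each surface of a tower carries a finite invariant measure of its own.
\<close>
theorem lattice_measure_finite_index:
  assumes lat: "psl_lattice G" and sub: "subgroup H PSL2R" "H \<subseteq> G"
    and fin: "finite (rcosets\<^bsub>PSL2R\<lparr>carrier := G\<rparr>\<^esub> H)"
  obtains \<mu> where "lattice_measure \<mu> (\<Union>H)"
proof -
  have lattice: "subgroup G PSL2R" "subtopology psl_topology G = discrete_topology G"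
    using lat by (auto simp: psl_lattice_def)
  obtain M where M: "space M = topspace (T1 G)"
    "sets M = sigma_sets (topspace (T1 G)) {U. openin (T1 G) U}"
    "finite_measure M" "emeasure M (space M) \<noteq> 0"
    "\<And>g A. g \<in> carrier PSL2R \<Longrightarrow> A \<in> sets M \<Longrightarrow>
      emeasure M ((\<lambda>x. x #>\<^bsub>PSL2R\<^esub> g) ` A) = emeasure M A"
    using lat unfolding psl_lattice_def by blast
  interpret finite_index_in_lattice G H M
    using lattice(1) sub finite_matrix_cosets[OF lattice(1) sub(1) fin] M(1-4) M(5)[OF psl_class_carrier]
    by (rule finite_index_in_lattice.intro)
  have "discrete_subgroup (\<Union>G)" using lattice by (rule discrete_subgroup_matrices)
  then obtain \<epsilon> where \<epsilon>: "\<epsilon> > 0" "\<And>A. A \<in> \<Union>G \<Longrightarrow> near \<epsilon> A \<Longrightarrow> A = mat 1"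
    by (rule discrete_subgroup_isolated) blast
  have "\<Union>H \<subseteq> \<Union>G" using sub(2) by (rule Union_mono)
  then have "\<forall>A\<in>\<Union>H. near \<epsilon> A \<longrightarrow> A = mat 1" using \<epsilon>(2) by blast
  then have "discrete_subgroup (\<Union>H)"
    unfolding discrete_subgroup_def using subgroup_matrices[OF sub(1)] \<epsilon>(1) by blast
  then show ?thesis using lattice_measure_cover that by blast
qed

lemma horo_qt:
  assumes "subgroup \<Gamma> PSL2R" "det A = 1"
  shows "horo s (qt \<Gamma> A) = qt \<Gamma> (A ** up s)"
  unfolding horo_def mk_def[symmetric] by (rule qt_mult[OF assms]) simp

lemma covering_tower_props:
  assumes "covering_tower \<Gamma>"
  shows "subgroup (\<Gamma> n) PSL2R" "m \<le> n \<Longrightarrow> \<Gamma> n \<subseteq> \<Gamma> m"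
  using assms lift_Suc_antimono_le[of \<Gamma> m n] unfolding covering_tower_def by blast+

lemma topspace_inv_limit:
  "y \<in> topspace (inv_limit \<Gamma>) \<longleftrightarrow>
     (\<forall>n. y n \<in> topspace (T1 (\<Gamma> n))) \<and> (\<forall>n. cov (\<Gamma> n) (y (Suc n)) = y n)"
  by (auto simp: inv_limit_def PiE_UNIV_domain)

lemma cov_qt:
  assumes "covering_tower \<Gamma>" "det A = 1"
  shows "cov (\<Gamma> n) (qt (\<Gamma> (Suc n)) A) = qt (\<Gamma> n) A"
  using covering_tower_props[OF assms(1)] assms(2)
  by (intro cov_r_coset) (auto simp: psl_class_carrier)

text \<open>
  A matrix that represents a component of a point of the inverse limit represents all earlier
  components as well.
\<close>
lemma inv_limit_component:
  assumes T: "covering_tower \<Gamma>" and y: "y \<in> topspace (inv_limit \<Gamma>)"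
    and g: "det g = 1" "y n = qt (\<Gamma> n) g" and "m \<le> n"
  shows "y m = qt (\<Gamma> m) g"
  using \<open>m \<le> n\<close>
proof (induction rule: inc_induct)
  case base
  show ?case by (rule g)
next
  case (step m)
  have "y m = cov (\<Gamma> m) (y (Suc m))" using y by (simp add: topspace_inv_limit)
  also have "\<dots> = qt (\<Gamma> m) g" unfolding step.IH by (rule cov_qt[OF T g(1)])
  finally show ?case .
qed

lemma inv_limit_lift:
  assumes "y \<in> topspace (inv_limit \<Gamma>)"
  obtains g where "det g = 1" "y n = qt (\<Gamma> n) g"
proof -
  have "y n \<in> topspace (T1 (\<Gamma> n))" using assms by (simp add: topspace_inv_limit)
  then show ?thesis using that unfolding topspace_T1_qt by blast
qed

lemma limit_horo_in_inv_limit: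
  assumes T: "covering_tower \<Gamma>" and y: "y \<in> topspace (inv_limit \<Gamma>)"
  shows "limit_horo s y \<in> topspace (inv_limit \<Gamma>)"
  unfolding topspace_inv_limit limit_horo_def
proof (intro conjI allI)
  fix n
  obtain g where g: "det g = 1" "y (Suc n) = qt (\<Gamma> (Suc n)) g" using inv_limit_lift[OF y] .
  have gn: "y n = qt (\<Gamma> n) g" by (rule inv_limit_component[OF T y g]) simp
  note sub = covering_tower_props(1)[OF T]
  have gs: "det (g ** up s) = 1" using g(1) by (simp add: det_mul)
  show "horo s (y n) \<in> topspace (T1 (\<Gamma> n))"
    unfolding gn horo_qt[OF sub g(1)] topspace_T1_qt using gs by blast
  show "cov (\<Gamma> n) (horo s (y (Suc n))) = horo s (y n)"
    unfolding gn g(2) horo_qt[OF sub g(1)] by (rule cov_qt[OF T gs])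
qed

theorem theorem1:
  fixes \<Gamma> :: "nat \<Rightarrow> psl set" and y :: "nat \<Rightarrow> psl set"
  assumes "covering_tower \<Gamma>"
    and "y \<in> topspace (inv_limit \<Gamma>)"
  shows "inv_limit \<Gamma> closure_of limit_orbit y = topspace (inv_limit \<Gamma>) \<or>
    (\<exists>x\<in>topspace (T1 (\<Gamma> 0)). horo_periodic x \<and> limit_proj ` limit_orbit y = horo_orbit x)"
proof (cases "\<exists>n g s. det g = 1 \<and> y n = qt (\<Gamma> n) g \<and> s \<noteq> 0 \<and> g ** up s ** adj g \<in> \<Union>(\<Gamma> n)")
  case True
  then obtain n g s where g: "det g = 1" "y n = qt (\<Gamma> n) g" and s: "s \<noteq> 0"
    and L: "g ** up s ** adj g \<in> \<Union>(\<Gamma> n)" by blast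
  note sub = covering_tower_props(1)[OF assms(1)]
  \<comment> \<open>a horocycle closed at level \<open>n\<close> is closed at level 0, as \<open>\<Gamma> n \<subseteq> \<Gamma> 0\<close>\<close>
  have y0: "y 0 = qt (\<Gamma> 0) g" by (rule inv_limit_component[OF assms g]) simp
  have fix_y0: "horo t (y 0) = y 0" if "g ** up t ** adj g \<in> \<Union>(\<Gamma> 0)" for t
  proof -
    have "g ** up t = (g ** up t ** adj g) ** g" using g(1) by simp
    then have "\<exists>L\<in>\<Union>(\<Gamma> 0). g ** up t = L ** g" using that by (rule bexI)
    then have "qt (\<Gamma> 0) g = qt (\<Gamma> 0) (g ** up t)"
      using qt_eq_iff[OF sub g(1), of "g ** up t"] g(1) by (simp add: det_mul)
    then show ?thesis unfolding y0 horo_qt[OF sub g(1)] by simp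
  qed
  have L0: "g ** up s ** adj g \<in> \<Union>(\<Gamma> 0)"
    using L covering_tower_props(2)[OF assms(1), of 0 n] by blast
  then have "adj (g ** up s ** adj g) \<in> \<Union>(\<Gamma> 0)" by (rule subgroup_matrices(4)[OF sub])
  also have "adj (g ** up s ** adj g) = g ** up (-s) ** adj g"
    by (simp add: adj_mult matrix_mul_assoc)
  finally have "horo \<bar>s\<bar> (y 0) = y 0"
    using fix_y0 L0 by (cases "s > 0") auto
  then have "horo_periodic (y 0)" unfolding horo_periodic_def using s by (intro exI[of _ "\<bar>s\<bar>"]) simp
  moreover have "limit_proj ` limit_orbit y = horo_orbit (y 0)"
    by (auto simp: limit_proj_def limit_orbit_def limit_horo_def horo_orbit_def image_image)
  moreover have "y 0 \<in> topspace (T1 (\<Gamma> 0))" using assms(2) by (simp add: topspace_inv_limit)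
  ultimately show ?thesis by blast
next
  case False
  note sub = covering_tower_props(1)[OF assms(1)]
  have dense: "\<exists>s. g ** up s \<in> V"
    if g: "det g = 1" "y n = qt (\<Gamma> n) g"
      and V: "openSL V" "left_inv (\<Union>(\<Gamma> n)) V" "V \<noteq> {}" for n g V
  proof -
    have "psl_lattice (\<Gamma> 0)" "finite (rcosets\<^bsub>PSL2R\<lparr>carrier := \<Gamma> 0\<rparr>\<^esub> \<Gamma> n)"
      using assms(1) by (auto simp: covering_tower_def)
    then obtain \<mu> where "lattice_measure \<mu> (\<Union>(\<Gamma> n))"
      using lattice_measure_finite_index sub covering_tower_props(2)[OF assms(1)] by blast
    then show ?thesis
      using lattice_measure.horocycle_closed_or_dense[OF _ g(1)] False g V by blast
  qed
  have "topspace (inv_limit \<Gamma>) \<subseteq> inv_limit \<Gamma> closure_of limit_orbit y"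
  proof
    fix z assume z: "z \<in> topspace (inv_limit \<Gamma>)"
    have "\<exists>w\<in>limit_orbit y. w \<in> T" if T: "z \<in> T" "openin (inv_limit \<Gamma>) T" for T
    proof -
      obtain T' where T': "openin (product_topology (\<lambda>n. T1 (\<Gamma> n)) UNIV) T'"
        "T = T' \<inter> {y. \<forall>n. cov (\<Gamma> n) (y (Suc n)) = y n}"
        using T(2) unfolding inv_limit_def openin_subtopology by blast
      then obtain U where U: "finite {i. U i \<noteq> topspace (T1 (\<Gamma> i))}"
        "\<And>i. openin (T1 (\<Gamma> i)) (U i)" "z \<in> Pi\<^sub>E UNIV U" "Pi\<^sub>E UNIV U \<subseteq> T'"
        using T(1) unfolding openin_product_topology_alt by auto
      obtain n where n: "\<And>i. U i \<noteq> topspace (T1 (\<Gamma> i)) \<Longrightarrow> i \<le> n"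
        using U(1) unfolding finite_nat_set_iff_bounded_le by blast
      \<comment> \<open>a basic open set involves finitely many components, all of them determined by the last\<close>
      define V where "V = (\<Inter>i\<in>{..n}. {A \<in> SL. qt (\<Gamma> i) A \<in> U i})"
      have "openSL V"
        unfolding V_def using U(2) by (intro openin_Inter) (auto simp: openin_T1_iff)
      moreover have "left_inv (\<Union>(\<Gamma> n)) V"
        unfolding left_inv_def
      proof (intro conjI ballI)
        fix L A assume L: "L \<in> \<Union>(\<Gamma> n)" and A: "A \<in> V"
        have dA: "det A = 1" using A by (auto simp: V_def)
        have dL: "det L = 1" using L subgroup_matrices(1)[OF sub] by blast
        have "qt (\<Gamma> i) (L ** A) = qt (\<Gamma> i) A" if "i \<le> n" for i
        proof -
          have "L \<in> \<Union>(\<Gamma> i)" using L covering_tower_props(2)[OF assms(1) that] by blast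
          then show ?thesis
            using dA dL qt_eq_iff[OF sub, of A "L ** A" i] by (auto simp: det_mul)
        qed
        then show "L ** A \<in> V" using A dA dL by (simp add: V_def det_mul)
      qed (auto simp: V_def)
      moreover obtain gz where gz: "det gz = 1" "z n = qt (\<Gamma> n) gz" using inv_limit_lift[OF z] .
      have "z i \<in> U i" for i using U(3) by (auto simp: PiE_UNIV_domain)
      then have "qt (\<Gamma> i) gz \<in> U i" if "i \<le> n" for i
        using inv_limit_component[OF assms(1) z gz that] by metis
      then have "gz \<in> V" unfolding V_def using gz(1) by simp
      then have "V \<noteq> {}" by blast
      ultimately have V: "openSL V" "left_inv (\<Union>(\<Gamma> n)) V" "V \<noteq> {}" by simp_all
      obtain g where g: "det g = 1" "y n = qt (\<Gamma> n) g" using inv_limit_lift[OF assms(2)] .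
      obtain s where s: "g ** up s \<in> V" using dense[OF g V] by blast
      have ys: "limit_horo s y \<in> topspace (inv_limit \<Gamma>)"
        by (rule limit_horo_in_inv_limit[OF assms])
      have "limit_horo s y i \<in> U i" for i
      proof (cases "i \<le> n")
        case True
        then have "limit_horo s y i = qt (\<Gamma> i) (g ** up s)"
          using inv_limit_component[OF assms g True] horo_qt[OF sub g(1)]
          by (simp add: limit_horo_def)
        then show ?thesis using s True by (simp add: V_def)
      next
        case False
        then have "U i = topspace (T1 (\<Gamma> i))" using n by blast
        then show ?thesis using ys by (simp add: topspace_inv_limit)
      qed
      then have "limit_horo s y \<in> Pi\<^sub>E UNIV U" by (simp add: PiE_UNIV_domain)
      then have "limit_horo s y \<in> T'" using U(4) by (rule rev_subsetD)
      moreover have "limit_horo s y \<in> {y. \<forall>n. cov (\<Gamma> n) (y (Suc n)) = y n}"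
        using ys unfolding topspace_inv_limit by blast
      ultimately have "limit_horo s y \<in> T" unfolding T'(2) by (rule IntI)
      then show ?thesis unfolding limit_orbit_def by blast
    qed
    then have "\<exists>w. w \<in> limit_orbit y \<and> w \<in> T" if "z \<in> T \<and> openin (inv_limit \<Gamma>) T" for T
      using that by fast
    then show "z \<in> inv_limit \<Gamma> closure_of limit_orbit y"
      unfolding in_closure_of using z by (intro conjI allI impI)
  qed
  then have "inv_limit \<Gamma> closure_of limit_orbit y = topspace (inv_limit \<Gamma>)"
    by (rule subset_antisym[OF closure_of_subset_topspace])
  then show ?thesis by (rule disjI1)
qed

end
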